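(* Let $\mathbb{F}$ be a field and $d,r$ non-negative integers. If an $\mathbb{F}$-representable matroid $M$ has a rooted $(d,r)$-decomposition, then there exists an $\mathbb{F}$-representable matroid $N$ such that $M$ is a minor of $N$ and $\mathrm{cdd}(N)\le 2r\cdot(4^d-1)+1$.
   Context: For a matroid $M$ with rank function $r_M$ and disjoint sets $X,Y$ of elements, $\lambda_M(X,Y)=r_M(X)+r_M(Y)-r_M(X\cup Y)$. For pairwise disjoint sets $X_1,\dots,X_k$ of elements, $\lambda^*_M(X_1,\dots,X_k)=\max_{I\subseteq[k]}\lambda_M\big(\bigcup_{i\in I}X_i,\bigcup_{i\in[k]\setminus I}X_i\big)$. A rooted $(d,r)$-decomposition of $M$ is a rooted tree $T$ of depth $d$ (the depth being the maximum number of edges on a path from the root to a leaf) whose leaves are in one-to-one correspondence with the elements of $M$, such that for every inner vertex $v$ of $T$ with $k$ children, if $X_1,\dots,X_k$ are the sets of elements of $M$ assigned to the leaves of the $k$ subtrees rooted at the children of $v$, then $\lambda^*_M(X_1,\dots,X_k)\le r$. The contraction-deletion-depth $\mathrm{cdd}(M)$ is defined recursively: if $M$ has a single element, $\mathrm{cdd}(M)=1$; if $M$ is not connected, $\mathrm{cdd}(M)$ is the maximum of $\mathrm{cdd}$ over the components of $M$ (restrictions of $M$ to its components, a component being an inclusion-wise maximal set of elements any two of which lie in a common circuit); otherwise $\mathrm{cdd}(M)=1+\min_{e}\min\{\mathrm{cdd}(M/e),\mathrm{cdd}(M\setminus e)\}$, the minimum over elements $e$ of $M$. *)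

theory Defs
  imports Main
begin

text \<open>Matroids are given by a finite ground set E and a rank function rk
(only its values on subsets of E matter).\<close>

definition lin_indep :: "('a \<Rightarrow> nat \<Rightarrow> 'f::field) \<Rightarrow> 'a set \<Rightarrow> bool" where
  "lin_indep v Y \<longleftrightarrow>
     (\<forall>c :: 'a \<Rightarrow> 'f. (\<forall>i. (\<Sum>x\<in>Y. c x * v x i) = 0) \<longrightarrow> (\<forall>x\<in>Y. c x = 0))"

definition lin_rank :: "('a \<Rightarrow> nat \<Rightarrow> 'f::field) \<Rightarrow> 'a set \<Rightarrow> nat" where
  "lin_rank v X = Max {card Y | Y. Y \<subseteq> X \<and> lin_indep v Y}"

text \<open>(E, rk) is represented by the columns v x (x in E) of a matrix over 'f
with m rows.\<close>
definition representable :: "'f::field itself \<Rightarrow> 'a set \<Rightarrow> ('a set \<Rightarrow> nat) \<Rightarrow> bool" where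
  "representable _ E rk \<longleftrightarrow> finite E \<and>
     (\<exists>(v :: 'a \<Rightarrow> nat \<Rightarrow> 'f) (m::nat). (\<forall>x\<in>E. \<forall>i\<ge>m. v x i = 0) \<and>
        (\<forall>X\<subseteq>E. rk X = lin_rank v X))"

definition lam :: "('a set \<Rightarrow> nat) \<Rightarrow> 'a set \<Rightarrow> 'a set \<Rightarrow> nat" where
  "lam rk X Y = rk X + rk Y - rk (X \<union> Y)"

definition lam_star :: "('a set \<Rightarrow> nat) \<Rightarrow> 'i set \<Rightarrow> ('i \<Rightarrow> 'a set) \<Rightarrow> nat" where
  "lam_star rk P X = Max {lam rk (\<Union>i\<in>I. X i) (\<Union>i\<in>P - I. X i) | I. I \<subseteq> P}"

datatype 'a rtree = Leaf 'a | Node "'a rtree list"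

fun leaves :: "'a rtree \<Rightarrow> 'a list" where
  "leaves (Leaf x) = [x]"
| "leaves (Node ts) = concat (map leaves ts)"

fun depth :: "'a rtree \<Rightarrow> nat" where
  "depth (Leaf x) = 0"
| "depth (Node ts) = Suc (fold max (map depth ts) 0)"

fun width_ok :: "('a set \<Rightarrow> nat) \<Rightarrow> nat \<Rightarrow> 'a rtree \<Rightarrow> bool" where
  "width_ok rk k (Leaf x) = True"
| "width_ok rk k (Node ts) =
     (ts \<noteq> [] \<and> lam_star rk {..<length ts} (\<lambda>i. set (leaves (ts ! i))) \<le> k
      \<and> list_all (width_ok rk k) ts)"

definition rooted_decomposition ::
  "'a set \<Rightarrow> ('a set \<Rightarrow> nat) \<Rightarrow> nat \<Rightarrow> nat \<Rightarrow> 'a rtree \<Rightarrow> bool" where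
  "rooted_decomposition E rk d k T \<longleftrightarrow>
     distinct (leaves T) \<and> set (leaves T) = E \<and> depth T = d \<and> width_ok rk k T"

definition has_rooted_decomposition :: "'a set \<Rightarrow> ('a set \<Rightarrow> nat) \<Rightarrow> nat \<Rightarrow> nat \<Rightarrow> bool" where
  "has_rooted_decomposition E rk d k \<longleftrightarrow> (\<exists>T. rooted_decomposition E rk d k T)"

definition circuit :: "'a set \<Rightarrow> ('a set \<Rightarrow> nat) \<Rightarrow> 'a set \<Rightarrow> bool" where
  "circuit E rk C \<longleftrightarrow> C \<subseteq> E \<and> rk C < card C \<and> (\<forall>D. D \<subset> C \<longrightarrow> rk D = card D)"

definition component :: "'a set \<Rightarrow> ('a set \<Rightarrow> nat) \<Rightarrow> 'a set \<Rightarrow> bool" where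
  "component E rk S \<longleftrightarrow>
     (let P = (\<lambda>S. S \<subseteq> E \<and> (\<forall>x\<in>S. \<forall>y\<in>S. x \<noteq> y \<longrightarrow> (\<exists>C. circuit E rk C \<and> x \<in> C \<and> y \<in> C)))
      in P S \<and> (\<forall>S'. P S' \<and> S \<subseteq> S' \<longrightarrow> S' = S))"

definition connected_matroid :: "'a set \<Rightarrow> ('a set \<Rightarrow> nat) \<Rightarrow> bool" where
  "connected_matroid E rk \<longleftrightarrow> component E rk E"

definition contract_rk :: "('a set \<Rightarrow> nat) \<Rightarrow> 'a \<Rightarrow> 'a set \<Rightarrow> nat" where
  "contract_rk rk e X = rk (X \<union> {e}) - rk {e}"

definition is_minor :: "'a set \<Rightarrow> ('a set \<Rightarrow> nat) \<Rightarrow> 'b set \<Rightarrow> ('b set \<Rightarrow> nat) \<Rightarrow> bool" where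
  "is_minor E rk E' rk' \<longleftrightarrow>
     (\<exists>f C D. C \<subseteq> E' \<and> D \<subseteq> E' \<and> C \<inter> D = {} \<and> inj_on f E \<and> f ` E = E' - C - D \<and>
        (\<forall>X\<subseteq>E. rk X = rk' (f ` X \<union> C) - rk' C))"

inductive cdd_le :: "'a set \<Rightarrow> ('a set \<Rightarrow> nat) \<Rightarrow> nat \<Rightarrow> bool" where
  single: "card E = 1 \<Longrightarrow> 1 \<le> k \<Longrightarrow> cdd_le E rk k"
| disconnected: "card E \<noteq> 1 \<Longrightarrow> \<not> connected_matroid E rk \<Longrightarrow>
     (\<forall>S. component E rk S \<longrightarrow> cdd_le S rk k) \<Longrightarrow> cdd_le E rk k"
| contract: "card E \<noteq> 1 \<Longrightarrow> connected_matroid E rk \<Longrightarrow> e \<in> E \<Longrightarrow>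
     cdd_le (E - {e}) (contract_rk rk e) k \<Longrightarrow> cdd_le E rk (Suc k)"
| delete: "card E \<noteq> 1 \<Longrightarrow> connected_matroid E rk \<Longrightarrow> e \<in> E \<Longrightarrow>
     cdd_le (E - {e}) rk k \<Longrightarrow> cdd_le E rk (Suc k)"

definition cdd :: "'a set \<Rightarrow> ('a set \<Rightarrow> nat) \<Rightarrow> nat" where
  "cdd E rk = (LEAST k. cdd_le E rk k)"

end

theory Submission
  imports Defs HOL.Vector_Spaces "HOL-Library.Function_Algebras" "HOL-Library.Disjoint_Sets"
    "HOL-Library.Infinite_Set"
begin

text \<open>Let \<open>V\<^sub>1, \<dots>, V\<^sub>n\<close> be the subspaces spanned by the elements below the children of the root, and
  let \<open>U\<^sub>i\<close> be the intersection of \<open>V\<^sub>i\<close> with the sum of the earlier ones. Distributing the children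
  greedily over two sides shows that the sum \<open>W\<close> of all \<open>U\<^sub>i\<close> has dimension at most \<open>3r\<close>. Projecting
  the vectors in \<open>V\<^sub>i\<close> along \<open>U\<^sub>i\<close> onto a complement makes the blocks independent, raises each
  connectivity inside a block by at most \<open>3r\<close>, and changes the vectors by elements of \<open>W\<close>. Each of
  the at most \<open>3r\<close> rank-one changes is realised by two additional elements: contracting the first
  and deleting the second gives the old matroid, contracting the second and deleting the first gives
  the new one. Hence the bound \<open>c(d, r)\<close> satisfies \<open>c(d, r) \<le> 6r + c(d - 1, 4r)\<close> with
  \<open>c(0, r) = 1\<close>.\<close>

section \<open>Matroid rank functions\<close>

definition direct_sum :: "('a set \<Rightarrow> nat) \<Rightarrow> 'a set \<Rightarrow> 'a set \<Rightarrow> bool" where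
  "direct_sum rk A B \<longleftrightarrow> A \<inter> B = {} \<and> rk (A \<union> B) = rk A + rk B"

lemma direct_sum_commute: "direct_sum rk A B \<longleftrightarrow> direct_sum rk B A"
  by (auto simp: direct_sum_def Un_commute Int_commute)

definition circuit_clique :: "'a set \<Rightarrow> ('a set \<Rightarrow> nat) \<Rightarrow> 'a set \<Rightarrow> bool" where
  "circuit_clique E rk S \<longleftrightarrow>
     S \<subseteq> E \<and> (\<forall>x\<in>S. \<forall>y\<in>S. x \<noteq> y \<longrightarrow> (\<exists>C. circuit E rk C \<and> x \<in> C \<and> y \<in> C))"

lemma component_iff_maximal_circuit_clique:
  "component E rk S \<longleftrightarrow>
     circuit_clique E rk S \<and> (\<forall>S'. circuit_clique E rk S' \<and> S \<subseteq> S' \<longrightarrow> S' = S)"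
  by (simp add: component_def circuit_clique_def Let_def)

lemma circuit_antichain: "circuit E rk C \<Longrightarrow> circuit E rk D \<Longrightarrow> \<not> C \<subset> D"
  unfolding circuit_def by (metis less_irrefl)

locale matroid_rank =
  fixes E :: "'a set" and rk :: "'a set \<Rightarrow> nat"
  assumes finite_ground: "finite E"
    and rk_le_card: "X \<subseteq> E \<Longrightarrow> rk X \<le> card X"
    and rk_mono: "X \<subseteq> Y \<Longrightarrow> Y \<subseteq> E \<Longrightarrow> rk X \<le> rk Y"
    and rk_submod: "X \<subseteq> E \<Longrightarrow> Y \<subseteq> E \<Longrightarrow> rk (X \<union> Y) + rk (X \<inter> Y) \<le> rk X + rk Y"
begin

lemma finite_subset_ground: "X \<subseteq> E \<Longrightarrow> finite X"
  using finite_ground finite_subset by blast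

lemma rk_empty: "rk {} = 0"
  using rk_le_card[of "{}"] by simp

lemma rk_Un_le: "X \<subseteq> E \<Longrightarrow> Y \<subseteq> E \<Longrightarrow> rk (X \<union> Y) \<le> rk X + rk Y"
  using rk_submod[of X Y] by simp

lemma rk_insert_le: "X \<subseteq> E \<Longrightarrow> e \<in> E \<Longrightarrow> rk (insert e X) \<le> Suc (rk X)"
  using rk_Un_le[of X "{e}"] rk_le_card[of "{e}"] by simp

lemma matroid_rank_subset: "F \<subseteq> E \<Longrightarrow> matroid_rank F rk"
  by unfold_locales (auto intro: finite_subset_ground rk_le_card rk_mono rk_submod)

lemma matroid_rank_contract:
  assumes "e \<in> E"
  shows "matroid_rank (E - {e}) (contract_rk rk e)"
proof
  have rk_singleton_le: "rk {e} \<le> rk (insert e X)" if "X \<subseteq> E" for X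
    using rk_mono[of "{e}" "insert e X"] that assms by auto
  show "finite (E - {e})" using finite_ground by simp
  show "contract_rk rk e X \<le> card X" if "X \<subseteq> E - {e}" for X
  proof -
    have "X \<subseteq> E" using that by blast
    then show ?thesis
      using rk_Un_le[of X "{e}"] assms rk_le_card[of X] by (simp add: contract_rk_def)
  qed
  show "contract_rk rk e X \<le> contract_rk rk e Y" if "X \<subseteq> Y" "Y \<subseteq> E - {e}" for X Y
  proof -
    have "insert e X \<subseteq> insert e Y" "insert e Y \<subseteq> E" using that assms by auto
    then show ?thesis
      using rk_mono[of "insert e X" "insert e Y"] by (simp add: contract_rk_def)
  qed
  show "contract_rk rk e (X \<union> Y) + contract_rk rk e (X \<inter> Y)
      \<le> contract_rk rk e X + contract_rk rk e Y"
    if "X \<subseteq> E - {e}" "Y \<subseteq> E - {e}" for X Y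
  proof -
    have "rk (insert e (X \<union> Y)) + rk (insert e (X \<inter> Y)) \<le> rk (insert e X) + rk (insert e Y)"
      using rk_submod[of "insert e X" "insert e Y"] that assms by auto
    moreover have "X \<union> Y \<subseteq> E" "X \<inter> Y \<subseteq> E" "X \<subseteq> E" "Y \<subseteq> E" using that by auto
    ultimately show ?thesis
      using rk_singleton_le[of "X \<union> Y"] rk_singleton_le[of "X \<inter> Y"]
        rk_singleton_le[of X] rk_singleton_le[of Y]
      by (simp add: contract_rk_def)
  qed
qed

lemma indep_subset:
  assumes "X \<subseteq> Y" "Y \<subseteq> E" "rk Y = card Y"
  shows "rk X = card X"
proof -
  have sub: "X \<subseteq> E" "Y - X \<subseteq> E" "X \<union> (Y - X) = Y" using assms by auto
  have "rk Y \<le> rk X + rk (Y - X)" using rk_Un_le[of X "Y - X"] sub by simp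
  also have "\<dots> \<le> rk X + card (Y - X)" using rk_le_card sub by simp
  finally have "card Y \<le> rk X + card (Y - X)" using assms(3) by simp
  moreover have "card (Y - X) = card Y - card X" "card X \<le> card Y"
    using assms(1) finite_subset_ground[OF sub(1)] finite_subset_ground[OF assms(2)]
    by (simp_all add: card_Diff_subset card_mono)
  moreover have "rk X \<le> card X" using rk_le_card sub by simp
  ultimately show ?thesis by linarith
qed

lemma rk_insert_eq_mono:
  assumes "rk (insert x Y) = rk Y" "Y \<subseteq> Z" "Z \<subseteq> E" "x \<in> E"
  shows "rk (insert x Z) = rk Z"
proof -
  have "rk (Z \<union> insert x Y) + rk (Z \<inter> insert x Y) \<le> rk Z + rk (insert x Y)"
    using rk_submod[of Z "insert x Y"] assms by blast
  moreover have "Z \<union> insert x Y = insert x Z" using assms by blast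
  moreover have "rk Y \<le> rk (Z \<inter> insert x Y)"
    using rk_mono[of Y "Z \<inter> insert x Y"] assms by blast
  moreover have "rk Z \<le> rk (insert x Z)" using rk_mono[of Z "insert x Z"] assms by blast
  ultimately show ?thesis using assms(1) by simp
qed

lemma indep_spanning_subset_exists: "Y \<subseteq> E \<Longrightarrow> \<exists>Z\<subseteq>Y. rk Z = card Z \<and> rk Z = rk Y"
proof (induction Y rule: infinite_finite_induct)
  case (infinite A)
  then show ?case using finite_subset_ground by blast
next
  case empty
  then show ?case by (simp add: rk_empty)
next
  case (insert y Y)
  then obtain Z where Z: "Z \<subseteq> Y" "rk Z = card Z" "rk Z = rk Y" by blast
  show ?case
  proof (cases "rk (insert y Y) = rk Y")
    case True
    then show ?thesis using Z by (metis subset_insertI2)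
  next
    case False
    then have "rk (insert y Z) \<noteq> rk Z" using rk_insert_eq_mono[of y Z Y] Z insert by auto
    moreover have "rk (insert y Z) \<le> Suc (rk Z)" "rk Z \<le> rk (insert y Z)"
      using rk_insert_le[of Z y] rk_mono[of Z "insert y Z"] Z insert by auto
    moreover have "rk (insert y Y) \<le> Suc (rk Y)" "rk (insert y Z) \<le> rk (insert y Y)"
      using rk_insert_le[of Y y] rk_mono[of "insert y Z" "insert y Y"] Z insert by auto
    moreover have "card (insert y Z) = Suc (card Z)"
      using Z insert by (metis card_insert_disjoint finite_subset subsetD)
    ultimately show ?thesis using Z by (intro exI[of _ "insert y Z"]) auto
  qed
qed

section \<open>Circuits and components\<close>

lemma circuit_exists: "X \<subseteq> E \<Longrightarrow> rk X < card X \<Longrightarrow> \<exists>C\<subseteq>X. circuit E rk C"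
proof (induction "card X" arbitrary: X rule: less_induct)
  case less
  show ?case
  proof (cases "\<forall>D. D \<subset> X \<longrightarrow> rk D = card D")
    case True
    then show ?thesis using less.prems by (auto simp: circuit_def)
  next
    case False
    then obtain D where D: "D \<subset> X" "rk D \<noteq> card D" by blast
    then have "rk D < card D" "card D < card X" "D \<subseteq> E"
      using rk_le_card[of D] less.prems finite_subset_ground
      by (auto simp: psubset_card_mono le_neq_implies_less)
    then show ?thesis using less.hyps D by (meson order_trans psubset_imp_subset)
  qed
qed

lemma circuit_through:
  assumes "insert x Y \<subseteq> E" "x \<notin> Y" "rk (insert x Y) = rk Y"
  shows "\<exists>C. circuit E rk C \<and> x \<in> C \<and> C \<subseteq> insert x Y"
proof -
  obtain Z where Z: "Z \<subseteq> Y" "rk Z = card Z" "rk Z = rk Y"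
    using indep_spanning_subset_exists assms by blast
  have "rk (insert x Z) \<le> rk Y" using rk_mono[of "insert x Z" "insert x Y"] assms Z by auto
  moreover have "card (insert x Z) = Suc (card Z)"
    using Z assms finite_subset_ground
    by (metis card_insert_disjoint finite_insert finite_subset subsetD)
  ultimately obtain C where C: "C \<subseteq> insert x Z" "circuit E rk C"
    using circuit_exists[of "insert x Z"] Z assms by auto
  moreover have "x \<in> C"
  proof (rule ccontr)
    assume "x \<notin> C"
    then have "rk C = card C" using indep_subset[of C Z] C Z assms by blast
    then show False using C by (simp add: circuit_def)
  qed
  ultimately show ?thesis using Z by blast
qed

lemma rk_circuit_remove:
  assumes "circuit E rk C" "x \<in> C"
  shows "rk (insert x (C - {x})) = rk (C - {x})"
proof -
  have "rk (C - {x}) = card (C - {x})" "C \<subseteq> E" "rk C < card C"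
    using assms unfolding circuit_def by blast+
  moreover have "card C = Suc (card (C - {x}))"
    using assms calculation finite_subset_ground by (metis card.remove)
  moreover have "rk (C - {x}) \<le> rk C" using \<open>C \<subseteq> E\<close> by (intro rk_mono) auto
  ultimately have "rk C = rk (C - {x})" by linarith
  then show ?thesis using assms(2) by (simp add: insert_absorb)
qed

lemma strong_circuit_elimination:
  assumes C: "circuit E rk C1" "circuit E rk C2"
    and e: "e \<in> C1" "e \<in> C2" and x: "x \<in> C1" "x \<notin> C2"
  shows "\<exists>C. circuit E rk C \<and> x \<in> C \<and> C \<subseteq> C1 \<union> C2 - {e}"
proof -
  have sub: "C1 \<subseteq> E" "C2 \<subseteq> E" using C by (auto simp: circuit_def)
  define Y where "Y = C1 \<union> C2 - {e, x}"
  have "rk (insert x (insert e Y)) = rk (insert e Y)"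
    by (rule rk_insert_eq_mono[OF rk_circuit_remove[OF C(1) x(1)]])
      (use x e sub in \<open>auto simp: Y_def\<close>)
  also have "\<dots> = rk Y"
    by (rule rk_insert_eq_mono[OF rk_circuit_remove[OF C(2) e(2)]])
      (use x e sub in \<open>auto simp: Y_def\<close>)
  finally have "rk (insert x (insert e Y)) = rk Y" .
  moreover have "rk (insert x Y) \<le> rk (insert x (insert e Y))" "rk Y \<le> rk (insert x Y)"
    using rk_mono[of "insert x Y" "insert x (insert e Y)"] rk_mono[of Y "insert x Y"] x e sub
    by (auto simp: Y_def)
  ultimately have "rk (insert x Y) = rk Y" by simp
  then obtain C3 where "circuit E rk C3" "x \<in> C3" "C3 \<subseteq> insert x Y"
    using circuit_through[of x Y] x e sub by (auto simp: Y_def)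
  moreover have "insert x Y \<subseteq> C1 \<union> C2 - {e}" using x e by (auto simp: Y_def)
  ultimately show ?thesis by blast
qed

text \<open>Among the intersecting pairs of circuits through \<open>x\<close> and \<open>z\<close>, one with smallest union
  must contain a circuit through both: otherwise eliminating twice yields a pair with smaller
  union.\<close>

lemma common_circuit_of_intersecting:
  assumes "circuit E rk C1" "circuit E rk C2" "x \<in> C1" "z \<in> C2" "C1 \<inter> C2 \<noteq> {}"
  shows "\<exists>C. circuit E rk C \<and> x \<in> C \<and> z \<in> C"
  using assms
proof (induction "card (C1 \<union> C2)" arbitrary: C1 C2 rule: less_induct)
  case less
  show ?case
  proof (cases "x \<in> C2 \<or> z \<in> C1")
    case True
    then show ?thesis using less.prems(1-4) by blast
  next
    case False
    obtain e where e: "e \<in> C1" "e \<in> C2" using less.prems(5) by blast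
    obtain C3 where C3: "circuit E rk C3" "x \<in> C3" "C3 \<subseteq> C1 \<union> C2 - {e}"
      using strong_circuit_elimination[OF less.prems(1,2) e less.prems(3)] False by blast
    have "\<not> C3 \<subseteq> C1" using circuit_antichain[OF C3(1) less.prems(1)] C3 e by blast
    then obtain f where f: "f \<in> C3" "f \<in> C2" "f \<notin> C1" using C3 by blast
    show ?thesis
    proof (cases "z \<in> C3")
      case True
      then show ?thesis using C3 by blast
    next
      case z: False
      obtain C4 where C4: "circuit E rk C4" "z \<in> C4" "C4 \<subseteq> C2 \<union> C3 - {f}"
        using strong_circuit_elimination[OF less.prems(2) C3(1) f(2,1) less.prems(4) z] by blast
      have "\<not> C4 \<subseteq> C2" using circuit_antichain[OF C4(1) less.prems(2)] C4 f by blast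
      then have "C1 \<inter> C4 \<noteq> {}" using C4 C3 by blast
      moreover have "C1 \<union> C4 \<subset> C1 \<union> C2" using C3 C4 f by blast
      moreover have "finite (C1 \<union> C2)"
        using less.prems finite_subset_ground by (auto simp: circuit_def)
      ultimately show ?thesis
        by (intro less.hyps[OF _ less.prems(1) C4(1) less.prems(3) C4(2)] psubset_card_mono)
    qed
  qed
qed

lemma direct_sum_mono:
  assumes "direct_sum rk A B" "A \<union> B \<subseteq> E" "X \<subseteq> A" "Y \<subseteq> B"
  shows "direct_sum rk X Y"
proof -
  have AB: "A \<inter> B = {}" "rk (A \<union> B) = rk A + rk B" using assms(1) by (auto simp: direct_sum_def)
  have "rk (A \<union> (X \<union> B)) + rk (A \<inter> (X \<union> B)) \<le> rk A + rk (X \<union> B)"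
    using rk_submod[of A "X \<union> B"] assms by blast
  moreover have "A \<union> (X \<union> B) = A \<union> B" "A \<inter> (X \<union> B) = X" using AB(1) assms by blast+
  ultimately have X_B: "rk X + rk B \<le> rk (X \<union> B)" using AB(2) by simp
  have "rk (B \<union> (X \<union> Y)) + rk (B \<inter> (X \<union> Y)) \<le> rk B + rk (X \<union> Y)"
    using rk_submod[of B "X \<union> Y"] assms by blast
  moreover have "B \<union> (X \<union> Y) = X \<union> B" "B \<inter> (X \<union> Y) = Y" using AB(1) assms by blast+
  ultimately have "rk X + rk Y \<le> rk (X \<union> Y)" using X_B by simp
  moreover have "rk (X \<union> Y) \<le> rk X + rk Y" using assms by (intro rk_Un_le) auto
  ultimately show ?thesis using AB(1) assms by (auto simp: direct_sum_def)
qed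

lemma circuit_subset_summand:
  assumes AB: "direct_sum rk A B" "A \<union> B \<subseteq> E" and C: "circuit E rk C" "C \<subseteq> A \<union> B"
  shows "C \<subseteq> A \<or> C \<subseteq> B"
proof (rule ccontr)
  assume "\<not> ?thesis"
  then have "C \<inter> A \<subset> C" "C \<inter> B \<subset> C" using C by blast+
  then have "rk (C \<inter> A) = card (C \<inter> A)" "rk (C \<inter> B) = card (C \<inter> B)"
    using C(1) by (auto simp: circuit_def)
  moreover have "direct_sum rk (C \<inter> A) (C \<inter> B)" by (rule direct_sum_mono[OF AB]) auto
  moreover have "card (C \<inter> A \<union> C \<inter> B) = card (C \<inter> A) + card (C \<inter> B)"
    using AB C finite_subset_ground
    by (intro card_Un_disjoint) (auto simp: circuit_def direct_sum_def)
  moreover have "C \<inter> A \<union> C \<inter> B = C" using C by blast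
  ultimately show False using C(1) by (simp add: circuit_def direct_sum_def)
qed

lemma crossing_circuit_exists:
  assumes "S \<subseteq> E" "\<not> direct_sum rk S (E - S)"
  shows "\<exists>C. circuit E rk C \<and> \<not> C \<subseteq> S \<and> \<not> C \<subseteq> E - S"
proof -
  obtain A where A: "A \<subseteq> S" "rk A = card A" "rk A = rk S"
    using indep_spanning_subset_exists assms by blast
  obtain B where B: "B \<subseteq> E - S" "rk B = card B" "rk B = rk (E - S)"
    using indep_spanning_subset_exists[of "E - S"] by blast
  have union: "S \<union> (E - S) = E" using assms by blast
  then have "rk E < card A + card B"
    using rk_Un_le[of S "E - S"] assms A B by (simp add: direct_sum_def)
  moreover have "card (A \<union> B) = card A + card B"
    using A B assms finite_subset_ground[of A] finite_subset_ground[of B]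
    by (intro card_Un_disjoint) auto
  moreover have "rk (A \<union> B) \<le> rk E" using A(1) B(1) assms(1) by (intro rk_mono) auto
  ultimately obtain C where C: "C \<subseteq> A \<union> B" "circuit E rk C"
    using circuit_exists[of "A \<union> B"] A B assms by auto
  have dep: "rk C \<noteq> card C" using C(2) by (simp add: circuit_def)
  have "\<not> C \<subseteq> A" using indep_subset[of C A] dep A assms(1) by auto
  moreover have "\<not> C \<subseteq> B" using indep_subset[of C B] dep B by auto
  moreover have "C \<inter> S \<subseteq> A" "C - S \<subseteq> B" using A(1) B(1) C(1) by auto
  ultimately show ?thesis using C(2) by blast
qed

lemma circuit_clique_insert:
  assumes S: "circuit_clique E rk S" and C: "circuit E rk C" "y \<in> C" "y \<in> S" "z \<in> C"
  shows "circuit_clique E rk (insert z S)"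
proof -
  have "\<exists>D. circuit E rk D \<and> x \<in> D \<and> z \<in> D" if "x \<in> S" for x
  proof (cases "x = y")
    case True
    then show ?thesis using C by blast
  next
    case False
    then obtain C' where "circuit E rk C'" "x \<in> C'" "y \<in> C'"
      using S C(3) \<open>x \<in> S\<close> unfolding circuit_clique_def by blast
    then show ?thesis using common_circuit_of_intersecting[of C' C x z] C by blast
  qed
  moreover have "z \<in> E" using C by (auto simp: circuit_def)
  ultimately show ?thesis using S unfolding circuit_clique_def by blast
qed

lemma component_subset: "component E rk S \<Longrightarrow> S \<subseteq> E"
  by (simp add: component_iff_maximal_circuit_clique circuit_clique_def)

lemma component_nonempty:
  assumes "component E rk S" "E \<noteq> {}"
  shows "S \<noteq> {}"
proof
  assume "S = {}"
  moreover obtain x where "x \<in> E" using assms(2) by blast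
  then have "circuit_clique E rk {x}" by (simp add: circuit_clique_def)
  ultimately show False using assms(1) by (auto simp: component_iff_maximal_circuit_clique)
qed

lemma component_direct_sum:
  assumes "component E rk S"
  shows "direct_sum rk S (E - S)"
proof (rule ccontr)
  assume "\<not> ?thesis"
  then obtain C where C: "circuit E rk C" "\<not> C \<subseteq> S" "\<not> C \<subseteq> E - S"
    using crossing_circuit_exists component_subset[OF assms] by blast
  then obtain y z where yz: "y \<in> C" "y \<in> S" "z \<in> C" "z \<notin> S" by (auto simp: circuit_def)
  then have "circuit_clique E rk (insert z S)"
    using circuit_clique_insert C(1) assms by (auto simp: component_iff_maximal_circuit_clique)
  then show False using assms yz(4) by (auto simp: component_iff_maximal_circuit_clique)
qed

lemma connected_matroid_not_direct_sum:
  assumes "connected_matroid E rk" "E = A \<union> B" "A \<noteq> {}" "B \<noteq> {}"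
  shows "\<not> direct_sum rk A B"
proof
  assume sum: "direct_sum rk A B"
  obtain x y where xy: "x \<in> A" "y \<in> B" using assms by blast
  then have "x \<noteq> y" using sum by (auto simp: direct_sum_def)
  then obtain C where C: "circuit E rk C" "x \<in> C" "y \<in> C"
    using assms(1,2) xy
    unfolding connected_matroid_def component_iff_maximal_circuit_clique circuit_clique_def by blast
  then have "C \<subseteq> A \<or> C \<subseteq> B"
    using circuit_subset_summand[OF sum] assms(2) by (auto simp: circuit_def)
  then show False using C xy sum by (auto simp: direct_sum_def)
qed

lemma contract_rk_direct_sum:
  assumes "direct_sum rk A B" "A \<union> B \<subseteq> E" "e \<in> B" "X \<subseteq> A"
  shows "contract_rk rk e X = rk X"
  using direct_sum_mono[OF assms(1,2,4), of "{e}"] assms(3)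
  by (simp add: direct_sum_def contract_rk_def)

lemma direct_sum_contract:
  assumes "direct_sum rk A B" "A \<union> B \<subseteq> E" "e \<in> A \<union> B"
  shows "direct_sum (contract_rk rk e) (A - {e}) (B - {e})"
proof -
  have left: "direct_sum (contract_rk rk e) (A - {e}) (B - {e})"
    if AB: "direct_sum rk A B" "A \<union> B \<subseteq> E" and e: "e \<in> A" for A B
  proof -
    have "contract_rk rk e B = rk B"
      using contract_rk_direct_sum[of B A e B] AB e by (simp add: direct_sum_commute Un_commute)
    moreover have "B - {e} = B" using AB(1) e by (auto simp: direct_sum_def)
    moreover have "A - {e} \<union> B \<union> {e} = A \<union> B" "A - {e} \<union> {e} = A" using e by auto
    moreover have "rk {e} \<le> rk A" using AB e by (intro rk_mono) auto
    ultimately show ?thesis using AB(1) by (auto simp: direct_sum_def contract_rk_def)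
  qed
  show ?thesis
    using assms left[of A B] left[of B A] by (auto simp: direct_sum_commute)
qed

end

section \<open>Upper bounds on the contraction-deletion-depth\<close>

text \<open>The recursion for the contraction-deletion-depth without the connectivity side conditions,
  so that each rule may be applied whenever it is convenient. The empty matroid, which
  \<^const>\<open>cdd_le\<close> does not cover, is given the value 1.\<close>

inductive cdd_bound :: "'a set \<Rightarrow> ('a set \<Rightarrow> nat) \<Rightarrow> nat \<Rightarrow> bool" where
  small: "E \<subseteq> {x} \<Longrightarrow> 1 \<le> k \<Longrightarrow> cdd_bound E rk k"
| sum: "A \<noteq> {} \<Longrightarrow> B \<noteq> {} \<Longrightarrow> direct_sum rk A B \<Longrightarrow>
     cdd_bound A rk k \<Longrightarrow> cdd_bound B rk k \<Longrightarrow> cdd_bound (A \<union> B) rk k"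
| contract: "e \<in> E \<Longrightarrow> cdd_bound (E - {e}) (contract_rk rk e) k \<Longrightarrow> cdd_bound E rk (Suc k)"
| delete: "e \<in> E \<Longrightarrow> cdd_bound (E - {e}) rk k \<Longrightarrow> cdd_bound E rk (Suc k)"

lemma cdd_bound_pos: "cdd_bound E rk k \<Longrightarrow> 1 \<le> k"
  by (induction rule: cdd_bound.induct) auto

lemma cdd_bound_mono: "cdd_bound E rk k \<Longrightarrow> k \<le> l \<Longrightarrow> cdd_bound E rk l"
proof (induction arbitrary: l rule: cdd_bound.induct)
  case (small E x k rk)
  then show ?case by (intro cdd_bound.small) simp_all
next
  case (sum A B rk k)
  then show ?case by (intro cdd_bound.sum) simp_all
next
  case (contract e E rk k)
  then show ?case by (metis Suc_le_D Suc_le_mono cdd_bound.contract)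
next
  case (delete e E rk k)
  then show ?case by (metis Suc_le_D Suc_le_mono cdd_bound.delete)
qed

lemma cdd_bound_cong:
  "cdd_bound E rk k \<Longrightarrow> (\<And>X. X \<subseteq> E \<Longrightarrow> rk' X = rk X) \<Longrightarrow> cdd_bound E rk' k"
proof (induction arbitrary: rk' rule: cdd_bound.induct)
  case (small E x k rk)
  then show ?case by (intro cdd_bound.small)
next
  case (sum A B rk k)
  have "cdd_bound A rk' k" "cdd_bound B rk' k"
    by (rule sum.IH, simp add: sum.prems le_supI1 le_supI2)+
  moreover have "direct_sum rk' A B"
    using sum.hyps sum.prems[of A] sum.prems[of B] sum.prems[of "A \<union> B"]
    by (simp add: direct_sum_def)
  ultimately show ?case using sum.hyps by (intro cdd_bound.sum)
next
  case (contract e E rk k)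
  have "cdd_bound (E - {e}) (contract_rk rk' e) k"
  proof (rule contract.IH)
    fix X assume "X \<subseteq> E - {e}"
    then have "X \<union> {e} \<subseteq> E" "{e} \<subseteq> E" using contract.hyps by auto
    then show "contract_rk rk' e X = contract_rk rk e X"
      unfolding contract_rk_def by (simp only: contract.prems)
  qed
  then show ?case by (rule cdd_bound.contract[OF contract.hyps(1)])
next
  case (delete e E rk k)
  have "cdd_bound (E - {e}) rk' k"
    by (rule delete.IH) (use delete.prems in auto)
  then show ?case by (rule cdd_bound.delete[OF delete.hyps(1)])
qed

lemma cdd_bound_direct_sum:
  "direct_sum rk A B \<Longrightarrow> cdd_bound A rk k \<Longrightarrow> cdd_bound B rk k \<Longrightarrow> cdd_bound (A \<union> B) rk k"
  by (cases "A = {} \<or> B = {}") (auto intro: cdd_bound.sum)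

lemma cdd_bound_Diff_singleton: "cdd_bound (E - {e}) rk k \<Longrightarrow> cdd_bound E rk (Suc k)"
  by (cases "e \<in> E") (auto intro: cdd_bound.delete cdd_bound_mono)

lemma (in matroid_rank) cdd_bound_contract_summand:
  assumes "direct_sum rk X Y" "X \<union> Y \<subseteq> E" "e \<in> X \<union> Y" "cdd_bound (X - {e}) (contract_rk rk e) k"
  shows "cdd_bound X rk (Suc k)"
proof (cases "e \<in> X")
  case True
  then show ?thesis using assms(4) by (rule cdd_bound.contract)
next
  case False
  then have "cdd_bound X (contract_rk rk e) k" using assms(4) by simp
  then have "cdd_bound X rk k"
    by (rule cdd_bound_cong)
      (use False assms(3) contract_rk_direct_sum[OF assms(1,2)] in auto)
  then show ?thesis by (rule cdd_bound_mono) simp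
qed

lemma cdd_bound_summand:
  "cdd_bound E rk k \<Longrightarrow> matroid_rank E rk \<Longrightarrow> E = X \<union> Y \<Longrightarrow> direct_sum rk X Y \<Longrightarrow> cdd_bound X rk k"
proof (induction arbitrary: X Y rule: cdd_bound.induct)
  case (small E x k rk)
  then show ?case by (intro cdd_bound.small) auto
next
  case (sum A B rk k)
  interpret matroid_rank "A \<union> B" rk by (rule sum.prems)
  have restrict: "direct_sum rk (X \<inter> F) (Y \<inter> F)" for F
    using sum.prems by (intro direct_sum_mono[OF sum.prems(3)]) auto
  have "cdd_bound (X \<inter> A) rk k"
    by (rule sum.IH(1)[OF matroid_rank_subset _ restrict]) (use sum.prems(2) in auto)
  moreover have "cdd_bound (X \<inter> B) rk k"
    by (rule sum.IH(2)[OF matroid_rank_subset _ restrict]) (use sum.prems(2) in auto)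
  moreover have "direct_sum rk (X \<inter> A) (X \<inter> B)"
    by (rule direct_sum_mono[OF sum.hyps(3)]) auto
  ultimately have "cdd_bound (X \<inter> A \<union> X \<inter> B) rk k" by (intro cdd_bound_direct_sum)
  moreover have "X \<inter> A \<union> X \<inter> B = X" using sum.prems(2) by blast
  ultimately show ?case by simp
next
  case (contract e E rk k)
  interpret matroid_rank E rk by (rule contract.prems)
  have XY: "X \<union> Y \<subseteq> E" "e \<in> X \<union> Y" using contract.hyps(1) contract.prems(2) by simp_all
  have "cdd_bound (X - {e}) (contract_rk rk e) k"
    using contract.prems(2)
    by (intro contract.IH[OF matroid_rank_contract[OF contract.hyps(1)] _
          direct_sum_contract[OF contract.prems(3) XY]]) auto
  then show ?case by (rule cdd_bound_contract_summand[OF contract.prems(3) XY])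
next
  case (delete e E rk k)
  interpret matroid_rank E rk by (rule delete.prems)
  have "direct_sum rk (X - {e}) (Y - {e})"
    using delete.prems by (intro direct_sum_mono[OF delete.prems(3)]) auto
  moreover have "matroid_rank (E - {e}) rk" by (rule matroid_rank_subset) auto
  ultimately have "cdd_bound (X - {e}) rk k" using delete.prems(2) by (intro delete.IH) auto
  then show ?case by (rule cdd_bound_Diff_singleton)
qed

lemma (in matroid_rank) cdd_bound_component:
  assumes "cdd_bound E rk k" "component E rk S"
  shows "cdd_bound S rk k"
  using cdd_bound_summand[OF assms(1) matroid_rank_axioms _ component_direct_sum[OF assms(2)]]
    component_subset[OF assms(2)] by auto

lemma (in matroid_rank) cdd_bound_connectedE:
  assumes "cdd_bound E rk k" "connected_matroid E rk" "E \<noteq> {}" "card E \<noteq> 1"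
  obtains (contract) e l where "e \<in> E" "k = Suc l" "cdd_bound (E - {e}) (contract_rk rk e) l"
    | (delete) e l where "e \<in> E" "k = Suc l" "cdd_bound (E - {e}) rk l"
  using assms(1)
proof cases
  case (small x)
  then have "E = {x}" using assms(3) by blast
  then show ?thesis using assms(4) by simp
next
  case (sum A B)
  then show ?thesis using connected_matroid_not_direct_sum[OF assms(2)] by blast
qed (use that in blast)+

lemma cdd_bound_imp_cdd_le:
  "cdd_bound E rk k \<Longrightarrow> matroid_rank E rk \<Longrightarrow> E \<noteq> {} \<Longrightarrow> cdd_le E rk k"
proof (induction "card E" arbitrary: E rk k rule: less_induct)
  case less
  interpret matroid_rank E rk by (rule less.prems)
  consider (singleton) "card E = 1" | (disconnected) "card E \<noteq> 1" "\<not> connected_matroid E rk"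
    | (connected) "card E \<noteq> 1" "connected_matroid E rk" by blast
  then show ?case
  proof cases
    case singleton
    then show ?thesis using cdd_bound_pos[OF less.prems(1)] by (rule cdd_le.single)
  next
    case disconnected
    show ?thesis
    proof (rule cdd_le.disconnected[OF disconnected], intro allI impI)
      fix S assume S: "component E rk S"
      note sub = component_subset[OF S]
      have "S \<noteq> E" using S disconnected by (auto simp: connected_matroid_def)
      then have "card S < card E" using sub finite_ground by (simp add: psubset_card_mono psubsetI)
      then show "cdd_le S rk k"
        using less.hyps cdd_bound_component[OF less.prems(1) S] matroid_rank_subset[OF sub]
          component_nonempty[OF S less.prems(3)] by blast
    qed
  next
    case connected
    have smaller: "card (E - {e}) < card E" if "e \<in> E" for e
      using finite_ground that by (rule card_Diff1_less)
    have nonempty: "E - {e} \<noteq> {}" if "e \<in> E" for e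
      using that connected(1) by (auto simp: subset_singleton_iff)
    from less.prems(1) connected(2) less.prems(3) connected(1) show ?thesis
    proof (cases rule: cdd_bound_connectedE)
      case (contract e l)
      then show ?thesis
        using less.hyps[OF smaller] matroid_rank_contract nonempty
          cdd_le.contract[OF connected] by blast
    next
      case (delete e l)
      then show ?thesis
        using less.hyps[OF smaller] matroid_rank_subset[of "E - {e}"] nonempty
          cdd_le.delete[OF connected] by blast
    qed
  qed
qed

lemma cdd_upper_bound: "cdd_bound E rk k \<Longrightarrow> matroid_rank E rk \<Longrightarrow> E \<noteq> {} \<Longrightarrow> cdd E rk \<le> k"
  unfolding cdd_def by (rule Least_le) (rule cdd_bound_imp_cdd_le)

lemma lam_le_lam_star:
  "finite P \<Longrightarrow> I \<subseteq> P \<Longrightarrow> lam rk (\<Union>i\<in>I. X i) (\<Union>i\<in>P - I. X i) \<le> lam_star rk P X"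
  unfolding lam_star_def by (rule Max_ge) auto

section \<open>Dimensions of finitely spanned sets\<close>

context vector_space
begin

definition fin_dim :: "'b set \<Rightarrow> bool" where
  "fin_dim S \<longleftrightarrow> (\<exists>B. finite B \<and> S \<subseteq> span B)"

lemma fin_dim_finite: "finite S \<Longrightarrow> fin_dim S"
  using span_superset unfolding fin_dim_def by blast

lemma fin_dim_subset: "fin_dim T \<Longrightarrow> S \<subseteq> span T \<Longrightarrow> fin_dim S"
  unfolding fin_dim_def by (meson span_minimal subset_trans subspace_span)

lemma fin_dim_Int_span: "fin_dim S \<Longrightarrow> fin_dim (span S \<inter> T)"
  by (rule fin_dim_subset) auto

lemma fin_dim_Un:
  assumes "fin_dim S" "fin_dim T"
  shows "fin_dim (S \<union> T)"
proof -
  obtain A B where "finite A" "S \<subseteq> span A" "finite B" "T \<subseteq> span B"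
    using assms unfolding fin_dim_def by blast
  then have "finite (A \<union> B)" "S \<union> T \<subseteq> span (A \<union> B)"
    using span_mono[of A "A \<union> B"] span_mono[of B "A \<union> B"] by auto
  then show ?thesis unfolding fin_dim_def by blast
qed

lemma fin_dim_UN: "finite I \<Longrightarrow> (\<And>i. i \<in> I \<Longrightarrow> fin_dim (S i)) \<Longrightarrow> fin_dim (\<Union>i\<in>I. S i)"
  by (induction rule: finite_induct) (simp_all add: fin_dim_finite fin_dim_Un)

lemma finite_basis_exists:
  assumes "fin_dim S"
  obtains B where "B \<subseteq> S" "finite B" "independent B" "S \<subseteq> span B" "card B = dim S"
proof -
  obtain A where A: "finite A" "S \<subseteq> span A" using assms unfolding fin_dim_def by blast
  obtain B where B: "B \<subseteq> S" "independent B" "S \<subseteq> span B" "card B = dim S" by (rule basis_exists)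
  have "finite B" using independent_span_bound[OF A(1) B(2)] A(2) B(1) by blast
  then show thesis using that B by blast
qed

lemma dim_mono_fin_dim:
  assumes "fin_dim T" "S \<subseteq> span T"
  shows "dim S \<le> dim T"
proof -
  obtain B where B: "finite B" "T \<subseteq> span B" "card B = dim T"
    using finite_basis_exists[OF assms(1)] by metis
  have "S \<subseteq> span B" using assms(2) span_minimal[OF B(2)] by auto
  then show ?thesis using dim_le_card[OF _ B(1)] B(3) by simp
qed

lemma dim_subset_fin_dim: "fin_dim T \<Longrightarrow> S \<subseteq> T \<Longrightarrow> dim S \<le> dim T"
  using span_superset by (blast intro: dim_mono_fin_dim)

definition lin_disjoint :: "'b set \<Rightarrow> 'b set \<Rightarrow> bool" where
  "lin_disjoint S T \<longleftrightarrow> span S \<inter> span T = {0}"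

lemma lin_disjointI: "(\<And>x. x \<in> span S \<Longrightarrow> x \<in> span T \<Longrightarrow> x = 0) \<Longrightarrow> lin_disjoint S T"
  using span_zero by (auto simp: lin_disjoint_def)

lemma lin_disjointD: "lin_disjoint S T \<Longrightarrow> x \<in> span S \<Longrightarrow> x \<in> span T \<Longrightarrow> x = 0"
  by (auto simp: lin_disjoint_def)

lemma lin_disjoint_mono:
  assumes "lin_disjoint S T" "S' \<subseteq> span S" "T' \<subseteq> span T"
  shows "lin_disjoint S' T'"
  using assms(1) span_minimal[OF assms(2)] span_minimal[OF assms(3)]
  by (intro lin_disjointI) (auto dest: lin_disjointD)

lemma lin_disjoint_Un:
  assumes "lin_disjoint S T" "lin_disjoint S' T'" "lin_disjoint (S \<union> T) (S' \<union> T')"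
  shows "lin_disjoint (S \<union> S') (T \<union> T')"
proof (rule lin_disjointI)
  fix z assume "z \<in> span (S \<union> S')" "z \<in> span (T \<union> T')"
  then obtain s s' t t' where z: "z = s + s'" "z = t + t'"
    and s: "s \<in> span S" "s' \<in> span S'" and t: "t \<in> span T" "t' \<in> span T'"
    unfolding span_Un by blast
  have "s - t = t' - s'" using z by (simp add: algebra_simps)
  moreover have "s - t \<in> span (S \<union> T)"
    using s t span_mono[of S "S \<union> T"] span_mono[of T "S \<union> T"] by (intro span_diff) auto
  moreover have "t' - s' \<in> span (S' \<union> T')"
    using s t span_mono[of S' "S' \<union> T'"] span_mono[of T' "S' \<union> T'"] by (intro span_diff) auto
  ultimately have "s - t = 0" "t' - s' = 0" using lin_disjointD[OF assms(3)] by metis+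
  then have "s = t" "s' = t'" by auto
  then have "s = 0" "s' = 0"
    using s t lin_disjointD[OF assms(1)] lin_disjointD[OF assms(2)] by auto
  then show "z = 0" using z(1) by simp
qed

lemma lin_disjoint_if_independent_Un:
  assumes "independent (A \<union> B)" "A \<inter> B = {}"
  shows "lin_disjoint A B"
proof (rule lin_disjointI)
  fix x assume x: "x \<in> span A" "x \<in> span B"
  have indep: "independent A" using assms(1) by (rule independent_mono) simp
  have "representation A x = representation (A \<union> B) x"
    "representation B x = representation (A \<union> B) x"
    using x by (auto intro!: representation_extend[OF assms(1), symmetric])
  then have "representation A x b = 0" for b
    using representation_ne_zero[of A x b] representation_ne_zero[of B x b] assms(2) by auto
  then show "x = 0" using sum_nonzero_representation_eq[OF indep x(1)] by simp
qed

lemma independent_Un: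
  assumes "finite A" "independent A" "independent B" "lin_disjoint A B"
  shows "independent (A \<union> B)"
  using assms
proof (induction A rule: finite_induct)
  case empty
  then show ?case by simp
next
  case (insert a A)
  have a: "a \<notin> span A" "independent A" using insert by (simp_all add: independent_insert)
  have "lin_disjoint A B"
    by (rule lin_disjoint_mono[OF insert.prems(3)]) (auto intro: span_base)
  then have "independent (A \<union> B)" using insert a by blast
  moreover have "a \<notin> span (A \<union> B)"
  proof
    assume "a \<in> span (A \<union> B)"
    then obtain x y where xy: "a = x + y" "x \<in> span A" "y \<in> span B" unfolding span_Un by blast
    have "a - x \<in> span (insert a A)"
      using xy(2) span_mono[of A "insert a A"] by (intro span_diff) (auto intro: span_base)
    then have "y = 0" using xy lin_disjointD[OF insert.prems(3)] by simp
    then show False using xy a by simp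
  qed
  ultimately show ?case by (simp add: independent_insertI)
qed

lemma dim_Un_lin_disjoint:
  assumes "fin_dim S" "fin_dim T" "lin_disjoint S T"
  shows "dim (S \<union> T) = dim S + dim T"
proof -
  obtain A where A: "A \<subseteq> S" "finite A" "independent A" "S \<subseteq> span A" "card A = dim S"
    by (rule finite_basis_exists[OF assms(1)])
  obtain B where B: "B \<subseteq> T" "finite B" "independent B" "T \<subseteq> span B" "card B = dim T"
    by (rule finite_basis_exists[OF assms(2)])
  have AB: "lin_disjoint A B"
    using A(1) B(1) by (intro lin_disjoint_mono[OF assms(3)]) (auto intro: span_base)
  have "A \<inter> B \<subseteq> {0}" using lin_disjointD[OF AB] by (auto intro: span_base)
  then have "A \<inter> B = {}" using A(3) dependent_zero by blast
  then have "card (A \<union> B) = dim S + dim T" using A B by (simp add: card_Un_disjoint)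
  moreover have "independent (A \<union> B)" by (rule independent_Un[OF A(2,3) B(3) AB])
  moreover have "S \<union> T \<subseteq> span (A \<union> B)"
    using A(4) B(4) span_mono[of A "A \<union> B"] span_mono[of B "A \<union> B"] by auto
  ultimately show ?thesis using A(1) B(1) by (intro dim_unique[of "A \<union> B"]) auto
qed

lemma lin_disjoint_complement_exists:
  assumes "U \<subseteq> span V"
  shows "\<exists>C\<subseteq>span V. lin_disjoint C U \<and> V \<subseteq> span (C \<union> U)"
proof -
  obtain B where B: "B \<subseteq> U" "independent B" "U \<subseteq> span B" by (rule maximal_independent_subset)
  obtain B' where B': "B \<subseteq> B'" "B' \<subseteq> span V" "independent B'" "span V \<subseteq> span B'"
    using maximal_independent_subset_extend[of B "span V"] B assms by blast
  have split: "B' - B \<union> B = B'" using B'(1) by blast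
  have "lin_disjoint (B' - B) B"
    using lin_disjoint_if_independent_Un[of "B' - B" B] B'(3) split by auto
  then have "lin_disjoint (B' - B) U"
    by (rule lin_disjoint_mono) (use B(3) in \<open>auto intro: span_base\<close>)
  moreover have "span B' \<subseteq> span (B' - B \<union> U)" using B(1) by (intro span_mono) auto
  ultimately show ?thesis
    using B'(2,4) span_superset[of V] by (intro exI[of _ "B' - B"]) auto
qed

lemma dim_Un_span_Int:
  assumes fd: "fin_dim S" "fin_dim T"
  shows "dim (S \<union> T) + dim (span S \<inter> span T) = dim S + dim T"
proof -
  define U where "U = span S \<inter> span T"
  obtain C where C: "C \<subseteq> span S" "lin_disjoint C U" "S \<subseteq> span (C \<union> U)"
    using lin_disjoint_complement_exists[of U S] by (auto simp: U_def)
  have fin_dim_CU: "fin_dim C" "fin_dim U"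
    using C(1) by (auto intro: fin_dim_subset[OF fd(1)] simp: U_def)
  have span_U: "span U = U" by (simp add: U_def subspace_inter)
  have "lin_disjoint C T"
  proof (rule lin_disjointI)
    fix x assume x: "x \<in> span C" "x \<in> span T"
    then have "x \<in> U" using span_minimal[OF C(1)] by (auto simp: U_def)
    then show "x = 0" using lin_disjointD[OF C(2) x(1)] span_U by simp
  qed
  then have "dim (C \<union> T) = dim C + dim T" by (intro dim_Un_lin_disjoint fin_dim_CU fd)
  moreover have "dim (C \<union> U) = dim C + dim U" by (intro dim_Un_lin_disjoint fin_dim_CU C(2))
  moreover have "span (C \<union> U) = span S"
    using C(1,3) by (auto simp: span_eq U_def)
  moreover have "span (C \<union> T) = span (S \<union> T)"
  proof -
    have "U \<subseteq> span (C \<union> T)" using span_mono[of T "C \<union> T"] by (auto simp: U_def)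
    then have "span (C \<union> U) \<subseteq> span (C \<union> T)"
      by (intro span_minimal) (auto intro: span_base)
    then have "S \<subseteq> span (C \<union> T)" using C(3) by blast
    moreover have "C \<subseteq> span (S \<union> T)" using C(1) span_mono[of S "S \<union> T"] by blast
    ultimately show ?thesis by (auto simp: span_eq intro: span_base)
  qed
  ultimately show ?thesis unfolding U_def[symmetric] by (metis add.assoc add.commute dim_span)
qed

lemma dim_Un_submodular:
  assumes "fin_dim S" "fin_dim T" "R \<subseteq> span S" "R \<subseteq> span T"
  shows "dim (S \<union> T) + dim R \<le> dim S + dim T"
proof -
  have "dim R \<le> dim (span S \<inter> span T)"
    using assms by (intro dim_subset_fin_dim fin_dim_Int_span) auto
  then show ?thesis using dim_Un_span_Int[OF assms(1,2)] by simp
qed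

lemma matroid_rank_dim:
  assumes "finite E"
  shows "matroid_rank E (\<lambda>X. dim (v ` X))"
proof
  have fin_dim: "fin_dim (v ` X)" if "X \<subseteq> E" for X
    using assms that by (meson fin_dim_finite finite_imageI finite_subset)
  fix X Y assume Y: "Y \<subseteq> E"
  show "dim (v ` Y) \<le> card Y"
  proof -
    have "finite Y" using Y assms by (rule finite_subset)
    then show ?thesis using dim_le_card'[of "v ` Y"] card_image_le[of Y v] by simp
  qed
  show "dim (v ` X) \<le> dim (v ` Y)" if "X \<subseteq> Y"
    using that Y by (intro dim_subset_fin_dim fin_dim image_mono)
  show "dim (v ` (X \<union> Y)) + dim (v ` (X \<inter> Y)) \<le> dim (v ` X) + dim (v ` Y)" if "X \<subseteq> E"
    unfolding image_Un using that Y
    by (intro dim_Un_submodular fin_dim) (auto intro: span_base)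
qed (rule assms)

lemma span_Un_cong_diff:
  assumes "\<And>x. x \<in> X \<Longrightarrow> v x - v' x \<in> span U"
  shows "span (v ` X \<union> U) = span (v' ` X \<union> U)"
proof -
  have "span (w ` X \<union> U) \<subseteq> span (w' ` X \<union> U)"
    if diff: "\<And>x. x \<in> X \<Longrightarrow> w x - w' x \<in> span U" for w w'
  proof (rule span_minimal)
    have "w x \<in> span (w' ` X \<union> U)" if "x \<in> X" for x
    proof -
      have "w' x + (w x - w' x) \<in> span (w' ` X \<union> U)"
        using that diff span_mono[of U "w' ` X \<union> U"]
        by (intro span_add) (auto intro: span_base)
      then show ?thesis by simp
    qed
    then show "w ` X \<union> U \<subseteq> span (w' ` X \<union> U)" by (auto intro: span_base)
  qed simp
  moreover have "v' x - v x \<in> span U" if "x \<in> X" for x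
    using span_neg[OF assms[OF that]] by simp
  ultimately show ?thesis using assms by (meson subset_antisym)
qed

lemma dim_image_Un_perturb:
  assumes "finite X" "fin_dim U" "\<And>x. x \<in> X \<Longrightarrow> v x - v' x \<in> span U" "lin_disjoint (v' ` X) U"
  shows "dim (v ` X \<union> U) = dim (v' ` X) + dim U"
proof -
  have "dim (v ` X \<union> U) = dim (v' ` X \<union> U)"
    using assms(3) by (intro span_eq_dim span_Un_cong_diff)
  also have "\<dots> = dim (v' ` X) + dim U"
    using assms(1) by (intro dim_Un_lin_disjoint[OF _ assms(2,4)] fin_dim_finite) simp
  finally show ?thesis .
qed

lemma dim_span_Int_eq_lam:
  assumes "finite X" "finite Y"
  shows "dim (span (v ` X) \<inter> span (v ` Y)) = lam (\<lambda>Z. dim (v ` Z)) X Y"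
  using dim_Un_span_Int[of "v ` X" "v ` Y"] assms by (simp add: lam_def image_Un fin_dim_finite)

lemma lam_perturb_le:
  assumes fin: "finite X" "finite Y" "fin_dim U"
    and diff: "\<And>x. x \<in> X \<union> Y \<Longrightarrow> v x - v' x \<in> span U"
    and disjoint: "lin_disjoint (v' ` (X \<union> Y)) U"
  shows "lam (\<lambda>Z. dim (v' ` Z)) X Y \<le> lam (\<lambda>Z. dim (v ` Z)) X Y + dim U"
proof -
  have eq: "dim (v ` Z \<union> U) = dim (v' ` Z) + dim U" if "Z \<subseteq> X \<union> Y" for Z
  proof (rule dim_image_Un_perturb)
    show "finite Z" using fin(1,2) that by (meson finite_UnI finite_subset)
    show "lin_disjoint (v' ` Z) U"
      by (rule lin_disjoint_mono[OF disjoint]) (use that in \<open>auto intro: span_base\<close>)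
  qed (use that fin diff in auto)
  have "dim (v ` Z \<union> U) \<le> dim (v ` Z) + dim U" if "finite Z" for Z
    using dim_Un_submodular[of "v ` Z" U "{}"] fin that by (simp add: fin_dim_finite)
  note this[OF fin(1)] this[OF fin(2)]
  moreover have "dim (v ` (X \<union> Y)) \<le> dim (v ` (X \<union> Y) \<union> U)"
    using fin(1,2) by (intro dim_subset_fin_dim fin_dim_Un[OF fin_dim_finite fin(3)]) auto
  ultimately show ?thesis
    using eq[of X] eq[of Y] eq[of "X \<union> Y"] unfolding lam_def by simp
qed

section \<open>Overlaps of a sequence of subspaces\<close>

lemma dim_Int_exchange:
  assumes fd: "fin_dim A" "fin_dim B" "fin_dim X"
  shows "dim (span (A \<union> X) \<inter> span B) + dim (span X \<inter> span A)
    = dim (span A \<inter> span B) + dim (span X \<inter> span (A \<union> B))"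
proof -
  have "dim (A \<union> B) + dim (span A \<inter> span B) = dim A + dim B"
    by (intro dim_Un_span_Int fd)
  moreover have "dim (X \<union> A) + dim (span X \<inter> span A) = dim X + dim A"
    by (intro dim_Un_span_Int fd)
  moreover have "dim (X \<union> (A \<union> B)) + dim (span X \<inter> span (A \<union> B)) = dim X + dim (A \<union> B)"
    by (intro dim_Un_span_Int fin_dim_Un fd)
  moreover have "dim (A \<union> X \<union> B) + dim (span (A \<union> X) \<inter> span B) = dim (A \<union> X) + dim B"
    by (intro dim_Un_span_Int fin_dim_Un fd)
  ultimately show ?thesis by (simp add: Un_ac)
qed

lemma dim_Int_add_dim_Int_le:
  assumes fd: "fin_dim X"
  shows "dim (span X \<inter> span A) + dim (span X \<inter> span B)
    \<le> dim (span X \<inter> span (A \<union> B)) + dim (span X \<inter> span A \<inter> span B)"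
proof -
  let ?P = "span X \<inter> span A" and ?Q = "span X \<inter> span B"
  have "span ?P = ?P" "span ?Q = ?Q" by (simp_all add: subspace_inter)
  then have "span ?P \<inter> span ?Q = span X \<inter> span A \<inter> span B" by blast
  then have "dim (?P \<union> ?Q) + dim (span X \<inter> span A \<inter> span B) = dim ?P + dim ?Q"
    using dim_Un_span_Int[of ?P ?Q] by (simp add: fin_dim_Int_span fd)
  moreover have "dim (?P \<union> ?Q) \<le> dim (span X \<inter> span (A \<union> B))"
    using span_mono[of A "A \<union> B"] span_mono[of B "A \<union> B"]
    by (intro dim_subset_fin_dim fin_dim_Int_span fd) auto
  ultimately show ?thesis by simp
qed

text \<open>Adding the subspace spanned by \<open>X\<close> to the side \<open>A\<close> that it meets less enlarges the
  intersection \<open>Z\<close> of the two sides by at least half of what the overlap \<open>U\<close> adds to \<open>W \<union> Z\<close>.\<close>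

lemma dim_overlap_step:
  fixes A B X :: "'b set"
  defines "Z \<equiv> span A \<inter> span B"
    and "U \<equiv> span X \<inter> span (A \<union> B)"
    and "Z' \<equiv> span (A \<union> X) \<inter> span B"
  assumes fd: "fin_dim A" "fin_dim B" "fin_dim X" "fin_dim W"
    and W_le: "dim (W \<union> Z) \<le> 3 * dim Z"
    and meets_A_less: "dim (span X \<inter> span A) \<le> dim (span X \<inter> span B)"
  shows "dim (W \<union> U \<union> Z') \<le> 3 * dim Z'"
proof -
  have fd': "fin_dim Z" "fin_dim U" "fin_dim Z'"
    unfolding Z_def U_def Z'_def by (intro fin_dim_Int_span fin_dim_Un fd)+
  have Z_sub: "Z \<subseteq> Z'" using span_mono[of A "A \<union> X"] by (auto simp: Z_def Z'_def)
  have "U \<inter> Z = span X \<inter> span A \<inter> span B"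
    using span_mono[of A "A \<union> B"] by (auto simp: U_def Z_def)
  then have "2 * dim (span X \<inter> span A) \<le> dim U + dim (U \<inter> Z)"
    using dim_Int_add_dim_Int_le[OF fd(3), of A B] meets_A_less by (simp add: U_def)
  then have gain: "dim U + 2 * dim Z \<le> 2 * dim Z' + dim (U \<inter> Z)"
    using dim_Int_exchange[OF fd(1-3)] unfolding Z_def[symmetric] U_def[symmetric] Z'_def[symmetric]
    by linarith
  have "dim (W \<union> Z \<union> U) + dim (U \<inter> Z) \<le> dim (W \<union> Z) + dim U"
    by (intro dim_Un_submodular fin_dim_Un fd fd') (auto intro: span_base)
  moreover have "dim (W \<union> Z \<union> U \<union> Z') + dim Z \<le> dim (W \<union> Z \<union> U) + dim Z'"
    using Z_sub by (intro dim_Un_submodular fin_dim_Un fd fd') (auto intro: span_base)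
  moreover have "W \<union> Z \<union> U \<union> Z' = W \<union> U \<union> Z'" using Z_sub by blast
  ultimately show ?thesis using gain W_le by simp
qed

definition overlap :: "(nat \<Rightarrow> 'b set) \<Rightarrow> nat \<Rightarrow> 'b set" where
  "overlap G i = span (G i) \<inter> span (\<Union>j<i. G j)"

definition cut :: "(nat \<Rightarrow> 'b set) \<Rightarrow> nat \<Rightarrow> nat set \<Rightarrow> 'b set" where
  "cut G n I = span (\<Union>i\<in>I. G i) \<inter> span (\<Union>i\<in>{..<n} - I. G i)"

lemma cut_complement: "I \<subseteq> {..<n} \<Longrightarrow> cut G n ({..<n} - I) = cut G n I"
  by (simp add: cut_def double_diff Int_commute)

lemma fin_dim_UN_overlap: "(\<And>i. i < n \<Longrightarrow> fin_dim (G i)) \<Longrightarrow> fin_dim (\<Union>i<n. overlap G i)"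
  unfolding overlap_def by (intro fin_dim_UN fin_dim_Int_span) auto

lemma dim_UN_overlap_le_cut:
  assumes "\<And>i. i < n \<Longrightarrow> fin_dim (G i)"
  shows "\<exists>I\<subseteq>{..<n}. dim ((\<Union>i<n. overlap G i) \<union> cut G n I) \<le> 3 * dim (cut G n I)"
  using assms
proof (induction n)
  case 0
  then show ?case by (simp add: cut_def)
next
  case (Suc n)
  let ?S = "\<lambda>I. span (\<Union>i\<in>I. G i)" and ?W = "\<Union>i<n. overlap G i"
  obtain I0 where I0: "I0 \<subseteq> {..<n}" "dim (?W \<union> cut G n I0) \<le> 3 * dim (cut G n I0)"
    using Suc.IH Suc.prems less_SucI by blast
  obtain I where I: "I \<subseteq> {..<n}" "dim (?W \<union> cut G n I) \<le> 3 * dim (cut G n I)"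
    and smaller: "dim (span (G n) \<inter> ?S I) \<le> dim (span (G n) \<inter> ?S ({..<n} - I))"
  proof (cases "dim (span (G n) \<inter> ?S I0) \<le> dim (span (G n) \<inter> ?S ({..<n} - I0))")
    case True
    then show ?thesis using that I0 by blast
  next
    case False
    then show ?thesis
      using that[of "{..<n} - I0"] I0 by (simp add: cut_complement double_diff)
  qed
  have fd: "fin_dim (\<Union>i\<in>K. G i)" if "K \<subseteq> {..<n}" for K
    using that Suc.prems by (intro fin_dim_UN) (auto intro: finite_subset)
  have "(\<Union>i\<in>I. G i) \<union> (\<Union>i\<in>{..<n} - I. G i) = (\<Union>i<n. G i)" using I(1) by blast
  then have overlap_n: "overlap G n = span (G n) \<inter> span ((\<Union>i\<in>I. G i) \<union> (\<Union>i\<in>{..<n} - I. G i))"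
    by (simp add: overlap_def)
  have "{..<Suc n} - insert n I = {..<n} - I" using I(1) by auto
  then have cut_Suc: "cut G (Suc n) (insert n I) = span ((\<Union>i\<in>I. G i) \<union> G n) \<inter> ?S ({..<n} - I)"
    by (simp add: cut_def Un_commute)
  have "dim (?W \<union> overlap G n \<union> cut G (Suc n) (insert n I)) \<le> 3 * dim (cut G (Suc n) (insert n I))"
    unfolding overlap_n cut_Suc using I smaller Suc.prems
    by (intro dim_overlap_step fd fin_dim_UN_overlap) (auto simp: cut_def)
  then show ?case using I(1) by (intro exI[of _ "insert n I"]) (auto simp: lessThan_Suc Un_ac)
qed

lemma dim_cut_eq_lam:
  assumes "\<And>i. i < n \<Longrightarrow> finite (X i)" "I \<subseteq> {..<n}"
  shows "dim (cut (\<lambda>i. v ` X i) n I) = lam (\<lambda>Y. dim (v ` Y)) (\<Union>i\<in>I. X i) (\<Union>i\<in>{..<n} - I. X i)"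
proof -
  have "finite (\<Union>i\<in>K. X i)" if "K \<subseteq> {..<n}" for K
    using that assms(1) by (auto intro: finite_subset)
  note fin = this[OF assms(2)] this[of "{..<n} - I"]
  show ?thesis unfolding cut_def image_UN[symmetric] by (intro dim_span_Int_eq_lam fin) auto
qed

lemma dim_UN_overlap_le_lam_star:
  assumes fin: "\<And>i. i < n \<Longrightarrow> finite (X i)"
  shows "dim (\<Union>i<n. overlap (\<lambda>i. v ` X i) i) \<le> 3 * lam_star (\<lambda>Y. dim (v ` Y)) {..<n} X"
proof -
  let ?G = "\<lambda>i. v ` X i"
  have fd: "fin_dim (?G i)" if "i < n" for i using fin[OF that] by (simp add: fin_dim_finite)
  obtain I where I: "I \<subseteq> {..<n}"
    "dim ((\<Union>i<n. overlap ?G i) \<union> cut ?G n I) \<le> 3 * dim (cut ?G n I)"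
    using dim_UN_overlap_le_cut[of n ?G] fd by auto
  have "fin_dim (cut ?G n I)"
    unfolding cut_def using I(1) fd
    by (intro fin_dim_Int_span fin_dim_UN) (auto intro: finite_subset)
  then have "dim (\<Union>i<n. overlap ?G i) \<le> dim ((\<Union>i<n. overlap ?G i) \<union> cut ?G n I)"
    by (intro dim_subset_fin_dim fin_dim_Un fin_dim_UN_overlap fd) auto
  also have "\<dots> \<le> 3 * dim (cut ?G n I)" by (rule I(2))
  also have "dim (cut ?G n I) = lam (\<lambda>Y. dim (v ` Y)) (\<Union>i\<in>I. X i) (\<Union>i\<in>{..<n} - I. X i)"
    using fin I(1) by (rule dim_cut_eq_lam)
  also have "\<dots> \<le> lam_star (\<lambda>Y. dim (v ` Y)) {..<n} X"
    using I(1) by (intro lam_le_lam_star) simp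
  finally show ?thesis by simp
qed

definition block_projection :: "('c \<Rightarrow> 'b) \<Rightarrow> (nat \<Rightarrow> 'c set) \<Rightarrow> nat \<Rightarrow> ('c \<Rightarrow> 'b) \<Rightarrow> bool" where
  "block_projection v X n v' \<longleftrightarrow> (\<forall>i<n. v' ` X i \<subseteq> span (v ` X i) \<and>
     (\<forall>x\<in>X i. v x - v' x \<in> overlap (\<lambda>j. v ` X j) i) \<and>
     lin_disjoint (v' ` X i) (overlap (\<lambda>j. v ` X j) i))"

lemma projection_along_exists:
  assumes "U \<subseteq> span (v ` X)"
  shows "\<exists>v'. v' ` X \<subseteq> span (v ` X) \<and> (\<forall>x\<in>X. v x - v' x \<in> span U) \<and> lin_disjoint (v' ` X) U"
proof -
  obtain C where C: "C \<subseteq> span (v ` X)" "lin_disjoint C U" "v ` X \<subseteq> span (C \<union> U)"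
    using lin_disjoint_complement_exists[OF assms] by blast
  have "\<exists>c\<in>span C. v x - c \<in> span U" if "x \<in> X" for x
  proof -
    have "v x \<in> span (C \<union> U)" using C(3) that by blast
    then obtain c u where "v x = c + u" "c \<in> span C" "u \<in> span U" unfolding span_Un by blast
    then show ?thesis by (intro bexI[of _ c]) auto
  qed
  then obtain v' where v': "\<And>x. x \<in> X \<Longrightarrow> v' x \<in> span C \<and> v x - v' x \<in> span U" by metis
  moreover have "lin_disjoint (v' ` X) U"
    using v' by (intro lin_disjoint_mono[OF C(2)]) (auto intro: span_base)
  moreover have "span C \<subseteq> span (v ` X)" by (rule span_minimal[OF C(1)]) simp
  ultimately show ?thesis by blast
qed

lemma block_projection_exists:
  assumes disjoint: "disjoint_family_on X {..<n}"
  shows "\<exists>v'. block_projection v X n v'"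
proof -
  let ?U = "overlap (\<lambda>j. v ` X j)"
  have "\<exists>v'. v' ` X i \<subseteq> span (v ` X i) \<and> (\<forall>x\<in>X i. v x - v' x \<in> span (?U i)) \<and>
      lin_disjoint (v' ` X i) (?U i)" for i
    by (rule projection_along_exists) (simp add: overlap_def)
  then obtain p where p: "\<And>i. p i ` X i \<subseteq> span (v ` X i)"
    "\<And>i x. x \<in> X i \<Longrightarrow> v x - p i x \<in> span (?U i)" "\<And>i. lin_disjoint (p i ` X i) (?U i)"
    by metis
  have "span (?U i) = ?U i" for i by (simp add: overlap_def subspace_inter)
  note p' = p[unfolded this]
  define v' where "v' x = p (THE i. i < n \<and> x \<in> X i) x" for x
  have v': "v' x = p i x" if "i < n" "x \<in> X i" for i x
  proof -
    have "(THE i. i < n \<and> x \<in> X i) = i"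
      using that disjoint by (intro the_equality) (auto simp: disjoint_family_on_def)
    then show ?thesis by (simp add: v'_def)
  qed
  have "v' ` X i = p i ` X i" if "i < n" for i using v'[OF that] by (auto simp: image_iff)
  then have "block_projection v X n v'"
    unfolding block_projection_def using p' v' by simp
  then show ?thesis by blast
qed

lemma block_projection_diff_in_span:
  assumes "block_projection v X n v'" "x \<in> (\<Union>i<n. X i)"
  shows "v x - v' x \<in> span (\<Union>i<n. overlap (\<lambda>j. v ` X j) i)"
  using assms unfolding block_projection_def by (blast intro: span_base)

lemma lin_disjoint_block_projection:
  assumes "block_projection v X n v'" "i < n"
  shows "lin_disjoint (\<Union>j<i. v' ` X j) (v' ` X i)"
proof (rule lin_disjointI)
  let ?U = "overlap (\<lambda>j. v ` X j)"
  fix z assume z: "z \<in> span (\<Union>j<i. v' ` X j)" "z \<in> span (v' ` X i)"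
  have span_image: "v' ` X j \<subseteq> span (v ` X j)" if "j < n" for j
    using assms(1) that by (simp add: block_projection_def)
  have "v' ` X j \<subseteq> span (\<Union>j<i. v ` X j)" if "j < i" for j
    using span_image[of j] span_mono[of "v ` X j" "\<Union>j<i. v ` X j"] that assms(2) by auto
  then have "span (\<Union>j<i. v' ` X j) \<subseteq> span (\<Union>j<i. v ` X j)" by (intro span_minimal) auto
  moreover have "span (v' ` X i) \<subseteq> span (v ` X i)"
    using span_image[OF assms(2)] by (intro span_minimal) auto
  ultimately have "z \<in> ?U i" using z by (auto simp: overlap_def)
  then have "z \<in> span (?U i)" by (rule span_base)
  then show "z = 0"
    using assms z(2) lin_disjointD unfolding block_projection_def by blast
qed

lemma lam_block_projection_le:
  assumes proj: "block_projection v X n v'" and "i < n" "Y \<subseteq> X i" "Z \<subseteq> X i"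
    and fin: "\<And>i. i < n \<Longrightarrow> finite (X i)"
  shows "lam (\<lambda>Z. dim (v' ` Z)) Y Z
    \<le> lam (\<lambda>Z. dim (v ` Z)) Y Z + dim (\<Union>i<n. overlap (\<lambda>j. v ` X j) i)"
proof -
  let ?U = "overlap (\<lambda>j. v ` X j)"
  have fd: "fin_dim (\<Union>i<n. ?U i)" by (intro fin_dim_UN_overlap fin_dim_finite) (simp add: fin)
  have "?U i \<subseteq> (\<Union>i<n. ?U i)" using assms(2) by blast
  then have U: "fin_dim (?U i)" "dim (?U i) \<le> dim (\<Union>i<n. ?U i)"
    using span_superset dim_subset_fin_dim[OF fd] by (blast intro: fin_dim_subset[OF fd])+
  have "lam (\<lambda>Z. dim (v' ` Z)) Y Z \<le> lam (\<lambda>Z. dim (v ` Z)) Y Z + dim (?U i)"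
  proof (rule lam_perturb_le[OF _ _ U(1)])
    show "finite Y" "finite Z" using assms(2-4) fin by (auto intro: finite_subset)
    show "v x - v' x \<in> span (?U i)" if "x \<in> Y \<union> Z" for x
      using that assms(2-4) proj unfolding block_projection_def by (blast intro: span_base)
    have "lin_disjoint (v' ` X i) (?U i)"
      using proj assms(2) by (simp add: block_projection_def)
    then show "lin_disjoint (v' ` (Y \<union> Z)) (?U i)"
      by (rule lin_disjoint_mono) (use assms(3,4) in \<open>auto intro: span_base\<close>)
  qed
  then show ?thesis using U(2) by simp
qed

end

section \<open>Representations over a field\<close>

definition fscale :: "'f::field \<Rightarrow> ('i \<Rightarrow> 'f) \<Rightarrow> 'i \<Rightarrow> 'f" where
  "fscale c x = (\<lambda>i. c * x i)"

interpretation fv: vector_space "fscale :: 'f::field \<Rightarrow> ('i \<Rightarrow> 'f) \<Rightarrow> 'i \<Rightarrow> 'f"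
  by unfold_locales (auto simp: fscale_def fun_eq_iff algebra_simps)

abbreviation vrank :: "('a \<Rightarrow> 'i \<Rightarrow> 'f::field) \<Rightarrow> 'a set \<Rightarrow> nat" where
  "vrank v X \<equiv> fv.dim (v ` X)"

lemma sum_fun_apply: "(\<Sum>x\<in>A. f x) i = (\<Sum>x\<in>A. f x i)"
  for f :: "'a \<Rightarrow> 'b \<Rightarrow> 'c::ab_group_add"
  by (induction A rule: infinite_finite_induct) auto

lemma lin_indep_iff_sum_fscale:
  "lin_indep v Y \<longleftrightarrow> (\<forall>c. (\<Sum>x\<in>Y. fscale (c x) (v x)) = 0 \<longrightarrow> (\<forall>x\<in>Y. c x = 0))"
  by (simp add: lin_indep_def fun_eq_iff sum_fun_apply fscale_def)

lemma lin_indep_imp_inj_on: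
  fixes v :: "'a \<Rightarrow> nat \<Rightarrow> 'f::field"
  assumes "finite Y" "lin_indep v Y"
  shows "inj_on v Y"
proof (rule inj_onI, rule ccontr)
  fix x y assume xy: "x \<in> Y" "y \<in> Y" "v x = v y" "x \<noteq> y"
  define c :: "'a \<Rightarrow> 'f" where "c z = (if z = x then 1 else if z = y then -1 else 0)" for z
  have "(\<Sum>z\<in>Y. fscale (c z) (v z)) = (\<Sum>z\<in>{x, y}. fscale (c z) (v z))"
    using xy assms(1) by (intro sum.mono_neutral_right) (auto simp: c_def)
  also have "\<dots> = 0" using xy by (simp add: c_def)
  finally have "c x = 0" using assms(2) xy(1) unfolding lin_indep_iff_sum_fscale by blast
  then show False by (simp add: c_def)
qed

lemma lin_indep_iff_independent:
  assumes "finite Y" "inj_on v Y"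
  shows "lin_indep v Y \<longleftrightarrow> fv.independent (v ` Y)"
proof
  assume indep: "lin_indep v Y"
  show "fv.independent (v ` Y)"
  proof (rule fv.independent_if_scalars_zero)
    fix f w assume "(\<Sum>w\<in>v ` Y. fscale (f w) w) = 0" "w \<in> v ` Y"
    then show "f w = 0"
      using indep unfolding lin_indep_iff_sum_fscale by (auto simp: sum.reindex[OF assms(2)])
  qed (simp add: assms(1))
next
  assume indep: "fv.independent (v ` Y)"
  show "lin_indep v Y"
    unfolding lin_indep_iff_sum_fscale
  proof (intro allI impI ballI)
    fix c x assume sum: "(\<Sum>x\<in>Y. fscale (c x) (v x)) = 0" and x: "x \<in> Y"
    have "(\<Sum>w\<in>v ` Y. fscale (c (inv_into Y v w)) w) = 0"
      using sum assms(2) by (simp add: sum.reindex cong: sum.cong)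
    then have "c (inv_into Y v (v x)) = 0"
      using fv.independentD[OF indep _ subset_refl, of "\<lambda>w. c (inv_into Y v w)"] assms(1) x by simp
    then show "c x = 0" using assms(2) x by simp
  qed
qed

lemma lin_rank_eq_vrank:
  assumes "finite X"
  shows "lin_rank v X = vrank v X"
  unfolding lin_rank_def
proof (rule Max_eqI)
  have "{card Y |Y. Y \<subseteq> X \<and> lin_indep v Y} \<subseteq> card ` Pow X" by blast
  then show "finite {card Y |Y. Y \<subseteq> X \<and> lin_indep v Y}"
    using assms by (meson finite_Pow_iff finite_imageI finite_subset)
next
  fix k assume "k \<in> {card Y |Y. Y \<subseteq> X \<and> lin_indep v Y}"
  then obtain Y where Y: "Y \<subseteq> X" "lin_indep v Y" "k = card Y" by blast
  have "finite Y" using Y(1) assms by (rule finite_subset)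
  then have "inj_on v Y" "fv.independent (v ` Y)"
    using Y(2) lin_indep_imp_inj_on lin_indep_iff_independent by blast+
  then have "k = vrank v Y" using Y(3) by (simp add: fv.dim_eq_card_independent card_image)
  also have "\<dots> \<le> vrank v X"
    using assms Y(1) by (intro fv.dim_subset_fin_dim fv.fin_dim_finite) auto
  finally show "k \<le> vrank v X" .
next
  obtain B where B: "B \<subseteq> v ` X" "fv.independent B" "card B = vrank v X" by (rule fv.basis_exists)
  then obtain Y where Y: "Y \<subseteq> X" "inj_on v Y" "B = v ` Y" by (meson subset_image_inj)
  have "finite Y" using Y(1) assms by (rule finite_subset)
  then have "lin_indep v Y" "card Y = vrank v X"
    using Y B lin_indep_iff_independent[of Y v] by (auto simp: card_image)
  then show "vrank v X \<in> {card Y |Y. Y \<subseteq> X \<and> lin_indep v Y}"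
    using Y(1) unfolding mem_Collect_eq by (intro exI[of _ Y]) simp
qed

definition supported_on :: "'i set \<Rightarrow> ('i \<Rightarrow> 'f::field) set" where
  "supported_on A = {x. \<forall>i. i \<notin> A \<longrightarrow> x i = 0}"

lemma subspace_supported_on: "fv.subspace (supported_on A)"
  by (rule fv.subspaceI) (auto simp: supported_on_def fscale_def)

lemma span_subset_supported_on: "S \<subseteq> supported_on A \<Longrightarrow> fv.span S \<subseteq> supported_on A"
  by (rule fv.span_minimal[OF _ subspace_supported_on])

lemma supported_on_mono: "A \<subseteq> B \<Longrightarrow> supported_on A \<subseteq> supported_on B"
  by (auto simp: supported_on_def)

lemma lin_disjoint_supported_on:
  assumes "S \<subseteq> supported_on A" "T \<subseteq> supported_on B" "A \<inter> B = {}"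
  shows "fv.lin_disjoint S T"
proof (rule fv.lin_disjointI)
  fix x assume "x \<in> fv.span S" "x \<in> fv.span T"
  then have "x \<in> supported_on A \<inter> supported_on B"
    using span_subset_supported_on[OF assms(1)] span_subset_supported_on[OF assms(2)] by blast
  then show "x = 0" using assms(3) by (auto simp: supported_on_def fun_eq_iff)
qed

definition unit_vec :: "'i \<Rightarrow> 'i \<Rightarrow> 'f::field" where
  "unit_vec i = (\<lambda>j. if j = i then 1 else 0)"

lemma unit_vec_image_subset_supported_on: "unit_vec ` A \<subseteq> supported_on A"
  by (auto simp: unit_vec_def supported_on_def)

lemma representable_iff_vrank:
  "representable TYPE('f::field) E rk \<longleftrightarrow> finite E \<and>
     (\<exists>(v :: 'a \<Rightarrow> nat \<Rightarrow> 'f) m. v ` E \<subseteq> supported_on {..<m} \<and> (\<forall>X\<subseteq>E. rk X = vrank v X))"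
proof -
  have "(\<forall>X\<subseteq>E. rk X = lin_rank v X) \<longleftrightarrow> (\<forall>X\<subseteq>E. rk X = vrank v X)"
    if "finite E" for v :: "'a \<Rightarrow> nat \<Rightarrow> 'f"
    using finite_subset[OF _ that] by (auto simp: lin_rank_eq_vrank)
  moreover have "(\<forall>x\<in>E. \<forall>i\<ge>m. v x i = 0) \<longleftrightarrow> v ` E \<subseteq> supported_on {..<m}"
    for v :: "'a \<Rightarrow> nat \<Rightarrow> 'f" and m
    by (simp add: supported_on_def image_subset_iff linorder_not_less)
  ultimately show ?thesis unfolding representable_def by (cases "finite E") simp_all
qed

section \<open>Extensions of a representation\<close>

abbreviation ground :: "'a set \<Rightarrow> nat set \<Rightarrow> nat set \<Rightarrow> ('a + nat) set" where
  "ground E C D \<equiv> Inl ` E \<union> Inr ` (C \<union> D)"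

text \<open>Deleting the elements \<open>Inr d\<close> with \<open>d \<in> D\<close> and contracting the elements \<open>Inr c\<close> with
  \<open>c \<in> C\<close> turns \<open>u\<close> into \<open>v\<close>. The vectors of \<open>v\<close> lie in the span of \<open>V\<close> and use only the
  coordinates below \<open>m\<close>; the other coordinates are available for the contracted elements.\<close>

locale extension =
  fixes V :: "(nat \<Rightarrow> 'f::field) set" and v :: "'a \<Rightarrow> nat \<Rightarrow> 'f" and E :: "'a set" and m :: nat
    and C D :: "nat set" and u :: "'a + nat \<Rightarrow> nat \<Rightarrow> 'f"
  assumes finite_E: "finite E" and finite_C: "finite C" and finite_D: "finite D"
    and disjoint: "C \<inter> D = {}"
    and fresh: "C \<union> D \<subseteq> {m..}"
    and V_supported: "V \<subseteq> supported_on {..<m}"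
    and v_in_span: "v ` E \<subseteq> fv.span V"
    and diff_in_span: "x \<in> E \<Longrightarrow> u (Inl x) - v x \<in> fv.span (unit_vec ` C)"
    and contracted: "c \<in> C \<Longrightarrow> u (Inr c) = unit_vec c"
    and deleted_in_span: "d \<in> D \<Longrightarrow> u (Inr d) \<in> fv.span (V \<union> unit_vec ` C)"
begin

lemma finite_ground: "finite (ground E C D)"
  by (simp add: finite_E finite_C finite_D)

lemma image_ground_subset_span: "u ` ground E C D \<subseteq> fv.span (V \<union> unit_vec ` C)"
proof -
  have V: "fv.span V \<subseteq> fv.span (V \<union> unit_vec ` C)"
    and units: "fv.span (unit_vec ` C) \<subseteq> fv.span (V \<union> unit_vec ` C)"
    by (rule fv.span_mono, blast)+
  have "u (Inl x) \<in> fv.span (V \<union> unit_vec ` C)" if "x \<in> E" for x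
  proof -
    have "v x + (u (Inl x) - v x) \<in> fv.span (V \<union> unit_vec ` C)"
      using that v_in_span diff_in_span V units by (intro fv.span_add) auto
    then show ?thesis by simp
  qed
  then show ?thesis using contracted deleted_in_span by (auto intro: fv.span_base)
qed

lemma span_subset_supported: "fv.span (V \<union> unit_vec ` C) \<subseteq> supported_on ({..<m} \<union> C)"
  using V_supported unit_vec_image_subset_supported_on[of C]
    supported_on_mono[of "{..<m}" "{..<m} \<union> C"] supported_on_mono[of C "{..<m} \<union> C"]
  by (intro span_subset_supported_on) blast

lemma lin_disjoint_contracted: "fv.lin_disjoint V (unit_vec ` C)"
  by (rule lin_disjoint_supported_on[OF V_supported unit_vec_image_subset_supported_on])
    (use fresh in auto)

lemma vrank_Un_contracted:
  assumes "X \<subseteq> E"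
  shows "vrank u (Inl ` X \<union> Inr ` C) = vrank v X + vrank u (Inr ` C)"
proof -
  have C: "u ` Inr ` C = unit_vec ` C" by (auto simp: image_iff contracted)
  have "fv.lin_disjoint (v ` X) (unit_vec ` C)"
    using v_in_span assms
    by (intro fv.lin_disjoint_mono[OF lin_disjoint_contracted]) (auto intro: fv.span_base)
  then have "fv.dim ((\<lambda>x. u (Inl x)) ` X \<union> u ` Inr ` C) = vrank v X + vrank u (Inr ` C)"
    unfolding C using assms finite_E finite_C diff_in_span
    by (intro fv.dim_image_Un_perturb) (auto intro: finite_subset fv.fin_dim_finite)
  then show ?thesis by (simp add: image_Un image_image)
qed

lemma is_minor_ground:
  assumes "\<And>X. X \<subseteq> E \<Longrightarrow> rk X = vrank v X"
  shows "is_minor E rk (ground E C D) (vrank u)"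
  unfolding is_minor_def
proof (intro exI conjI allI impI)
  show "Inr ` C \<subseteq> ground E C D" "Inr ` D \<subseteq> ground E C D" by auto
  show "Inr ` C \<inter> Inr ` D = {}" using disjoint by auto
  show "inj_on Inl E" by simp
  show "Inl ` E = ground E C D - Inr ` C - Inr ` D" by auto
  show "rk X = vrank u (Inl ` X \<union> Inr ` C) - vrank u (Inr ` C)" if "X \<subseteq> E" for X
    using that by (simp add: assms vrank_Un_contracted)
qed

lemma representable_ground: "representable TYPE('f) (ground E C D) (vrank u)"
proof -
  obtain n where "{..<m} \<union> C \<subseteq> {..<n}"
    using finite_nat_bounded[of "{..<m} \<union> C"] finite_C by blast
  then have "u ` ground E C D \<subseteq> supported_on {..<n}"
    using image_ground_subset_span span_subset_supported supported_on_mono by blast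
  then show ?thesis using finite_ground unfolding representable_iff_vrank by blast
qed

lemma matroid_rank_ground: "matroid_rank (ground E C D) (vrank u)"
  by (rule fv.matroid_rank_dim[OF finite_ground])

end

lemma extension_cong:
  assumes "extension V v E m C D u" "\<And>x. x \<in> E \<Longrightarrow> v' x = v x"
    "\<And>y. y \<in> ground E C D \<Longrightarrow> u' y = u y"
  shows "extension V v' E m C D u'"
proof -
  interpret extension V v E m C D u by (rule assms(1))
  show ?thesis
  proof
    show "C \<union> D \<subseteq> {m..}" by (rule fresh)
    show "v' ` E \<subseteq> fv.span V" using v_in_span assms(2) by auto
  qed (use assms(2,3) in \<open>simp_all add: finite_E finite_C finite_D disjoint fresh
        V_supported diff_in_span contracted deleted_in_span\<close>)
qed

lemma extension_mono:
  assumes "extension V v E m C D u" "V \<subseteq> fv.span V'" "V' \<subseteq> supported_on {..<m'}" "m' \<le> m"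
  shows "extension V' v E m' C D u"
proof -
  interpret extension V v E m C D u by (rule assms(1))
  have "fv.span V \<subseteq> fv.span V'" using assms(2) by (rule fv.span_minimal) simp
  moreover have "fv.span V' \<subseteq> fv.span (V' \<union> unit_vec ` C)" by (rule fv.span_mono) simp
  moreover have "fv.span (V \<union> unit_vec ` C) \<subseteq> fv.span (V' \<union> unit_vec ` C)"
    using assms(2) calculation by (intro fv.span_minimal) (auto intro: fv.span_base)
  ultimately have span: "fv.span V \<subseteq> fv.span V'"
    "fv.span (V \<union> unit_vec ` C) \<subseteq> fv.span (V' \<union> unit_vec ` C)" by blast+
  show ?thesis
  proof
    show "C \<union> D \<subseteq> {m'..}" using fresh assms(4) by auto
    show "v ` E \<subseteq> fv.span V'" using v_in_span span(1) by blast
    show "u (Inr d) \<in> fv.span (V' \<union> unit_vec ` C)" if "d \<in> D" for d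
      using deleted_in_span[OF that] span(2) by blast
  qed (simp_all add: finite_E finite_C finite_D disjoint assms(3) diff_in_span contracted)
qed

lemma extension_Un:
  fixes V V' :: "(nat \<Rightarrow> 'f::field) set"
  assumes "extension V v A m C D u" "extension V' v B m C' D' u" "(C \<union> D) \<inter> (C' \<union> D') = {}"
  shows "extension (V \<union> V') v (A \<union> B) m (C \<union> C') (D \<union> D') u"
proof -
  interpret A: extension V v A m C D u by (rule assms(1))
  interpret B: extension V' v B m C' D' u by (rule assms(2))
  have units: "fv.span (unit_vec ` C :: (nat \<Rightarrow> 'f) set) \<subseteq> fv.span (unit_vec ` (C \<union> C'))"
      "fv.span (unit_vec ` C' :: (nat \<Rightarrow> 'f) set) \<subseteq> fv.span (unit_vec ` (C \<union> C'))"
    and V: "fv.span V \<subseteq> fv.span (V \<union> V')" "fv.span V' \<subseteq> fv.span (V \<union> V')"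
    and V_units: "fv.span (V \<union> unit_vec ` C) \<subseteq> fv.span (V \<union> V' \<union> unit_vec ` (C \<union> C'))"
      "fv.span (V' \<union> unit_vec ` C') \<subseteq> fv.span (V \<union> V' \<union> unit_vec ` (C \<union> C'))"
    by (rule fv.span_mono, blast)+
  show ?thesis
  proof
    show "C \<union> C' \<union> (D \<union> D') \<subseteq> {m..}" using A.fresh B.fresh by blast
    show "(C \<union> C') \<inter> (D \<union> D') = {}" using A.disjoint B.disjoint assms(3) by blast
    show "V \<union> V' \<subseteq> supported_on {..<m}" using A.V_supported B.V_supported by blast
    show "v ` (A \<union> B) \<subseteq> fv.span (V \<union> V')" using A.v_in_span B.v_in_span V by blast
    show "u (Inl x) - v x \<in> fv.span (unit_vec ` (C \<union> C'))" if "x \<in> A \<union> B" for x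
      using that A.diff_in_span B.diff_in_span units by blast
    show "u (Inr c) = unit_vec c" if "c \<in> C \<union> C'" for c
      using that A.contracted B.contracted by blast
    show "u (Inr d) \<in> fv.span (V \<union> V' \<union> unit_vec ` (C \<union> C'))" if "d \<in> D \<union> D'" for d
      using that A.deleted_in_span B.deleted_in_span V_units by blast
  qed (simp_all add: A.finite_E B.finite_E A.finite_C B.finite_C A.finite_D B.finite_D)
qed

lemma direct_sum_extensions:
  assumes "extension V v A m C D u" "extension V' v B m C' D' u"
    and disjoint: "(C \<union> D) \<inter> (C' \<union> D') = {}" "A \<inter> B = {}" and "fv.lin_disjoint V V'"
  shows "direct_sum (vrank u) (ground A C D) (ground B C' D')"
proof -
  interpret A: extension V v A m C D u by (rule assms(1))
  interpret B: extension V' v B m C' D' u by (rule assms(2))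
  have "fv.lin_disjoint (unit_vec ` C) (unit_vec ` C')"
    using disjoint(1)
    by (intro lin_disjoint_supported_on[OF unit_vec_image_subset_supported_on
          unit_vec_image_subset_supported_on]) auto
  moreover have "fv.lin_disjoint (V \<union> V') (unit_vec ` C \<union> unit_vec ` C')"
    unfolding image_Un[symmetric] using A.V_supported B.V_supported A.fresh B.fresh
    by (intro lin_disjoint_supported_on[OF _ unit_vec_image_subset_supported_on, of _ "{..<m}"])
      auto
  ultimately have "fv.lin_disjoint (V \<union> unit_vec ` C) (V' \<union> unit_vec ` C')"
    by (rule fv.lin_disjoint_Un[OF assms(5)])
  then have "fv.lin_disjoint (u ` ground A C D) (u ` ground B C' D')"
    by (rule fv.lin_disjoint_mono[OF _ A.image_ground_subset_span B.image_ground_subset_span])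
  then have "vrank u (ground A C D \<union> ground B C' D')
      = vrank u (ground A C D) + vrank u (ground B C' D')"
    unfolding image_Un[of u "ground A C D" "ground B C' D'"]
    by (intro fv.dim_Un_lin_disjoint fv.fin_dim_finite finite_imageI
        A.finite_ground B.finite_ground)
  moreover have "ground A C D \<inter> ground B C' D' = {}" using disjoint by blast
  ultimately show ?thesis by (simp add: direct_sum_def)
qed

text \<open>The bound \<open>m\<close> is arbitrary so that extensions of disjoint blocks can be chosen with disjoint
  sets of new indices.\<close>

definition extendable :: "(nat \<Rightarrow> 'f::field) set \<Rightarrow> ('a \<Rightarrow> nat \<Rightarrow> 'f) \<Rightarrow> 'a set \<Rightarrow> nat \<Rightarrow> bool" where
  "extendable V v E k \<longleftrightarrow> (\<forall>m. V \<subseteq> supported_on {..<m} \<longrightarrow>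
     (\<exists>C D u. extension V v E m C D u \<and> cdd_bound (ground E C D) (vrank u) k))"

lemma extendableE:
  assumes "extendable V v E k" "V \<subseteq> supported_on {..<m}"
  obtains C D u where "extension V v E m C D u" "cdd_bound (ground E C D) (vrank u) k"
  using assms unfolding extendable_def by blast

lemma extendable_mono:
  assumes "extendable V v E k" "V \<subseteq> fv.span V'" "k \<le> l"
  shows "extendable V' v E l"
  unfolding extendable_def
proof (intro allI impI)
  fix m assume V': "V' \<subseteq> supported_on {..<m}"
  then have "V \<subseteq> supported_on {..<m}" using assms(2) span_subset_supported_on by blast
  with assms(1) obtain C D u
    where "extension V v E m C D u" "cdd_bound (ground E C D) (vrank u) k" by (rule extendableE)
  then show "\<exists>C D u. extension V' v E m C D u \<and> cdd_bound (ground E C D) (vrank u) l"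
    using extension_mono[OF _ assms(2) V'] cdd_bound_mono assms(3) by blast
qed

lemma extendable_cong:
  assumes "extendable V v E k" "\<And>x. x \<in> E \<Longrightarrow> v' x = v x"
  shows "extendable V v' E k"
  unfolding extendable_def
proof (intro allI impI)
  fix m assume "V \<subseteq> supported_on {..<m}"
  with assms(1) obtain C D u
    where u: "extension V v E m C D u" "cdd_bound (ground E C D) (vrank u) k" by (rule extendableE)
  have "extension V v' E m C D u" by (rule extension_cong[OF u(1) assms(2)]) simp_all
  then show "\<exists>C D u. extension V v' E m C D u \<and> cdd_bound (ground E C D) (vrank u) k"
    using u(2) by blast
qed

lemma extendable_small:
  assumes "E \<subseteq> {x}" "v ` E \<subseteq> fv.span V" "1 \<le> k"
  shows "extendable V v E k"
  unfolding extendable_def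
proof (intro allI impI exI conjI)
  fix m assume "V \<subseteq> supported_on {..<m}"
  then show "extension V v E m {} {} (case_sum v (\<lambda>_. 0))"
    using assms(1,2) by unfold_locales (auto intro: finite_subset)
  show "cdd_bound (ground E {} {}) (vrank (case_sum v (\<lambda>_. 0))) k"
    using assms(1,3) by (intro cdd_bound.small[of _ "Inl x"]) auto
qed

lemma extendable_avoiding:
  assumes "extendable V v E k" "V \<subseteq> supported_on {..<m}" "finite F"
  obtains C D u where "extension V v E m C D u" "(C \<union> D) \<inter> F = {}"
    "cdd_bound (ground E C D) (vrank u) k"
proof -
  obtain n where "F \<subseteq> {..<n}" using finite_nat_bounded[OF assms(3)] by blast
  then have F: "F \<subseteq> {..<max m n}" by auto
  have "V \<subseteq> supported_on {..<max m n}"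
    using assms(2) supported_on_mono[of "{..<m}" "{..<max m n}"] by auto
  with assms(1) obtain C D u where u: "extension V v E (max m n) C D u"
    "cdd_bound (ground E C D) (vrank u) k" by (rule extendableE)
  have "{max m n..} \<inter> {..<max m n} = {}" by auto
  then have "(C \<union> D) \<inter> F = {}" using F extension.fresh[OF u(1)] by blast
  moreover have "extension V v E m C D u"
    by (rule extension_mono[OF u(1) fv.span_superset assms(2)]) simp
  ultimately show thesis using that u(2) by blast
qed

lemma extendable_Un:
  assumes "extendable V v A k" "extendable V' v B k" "A \<inter> B = {}" "fv.lin_disjoint V V'"
  shows "extendable (V \<union> V') v (A \<union> B) k"
  unfolding extendable_def
proof (intro allI impI)
  fix m assume "V \<union> V' \<subseteq> supported_on {..<m}"
  then have V: "V \<subseteq> supported_on {..<m}" and V': "V' \<subseteq> supported_on {..<m}" by simp_all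
  obtain C D u where ext: "extension V v A m C D u"
    and bound: "cdd_bound (ground A C D) (vrank u) k"
    using assms(1) V by (rule extendableE)
  interpret extension V v A m C D u by (rule ext)
  have "finite (C \<union> D)" by (simp add: finite_C finite_D)
  with assms(2) V' obtain C' D' u' where ext': "extension V' v B m C' D' u'"
    and "(C' \<union> D') \<inter> (C \<union> D) = {}" and bound': "cdd_bound (ground B C' D') (vrank u') k"
    by (rule extendable_avoiding)
  then have index_disjoint: "(C \<union> D) \<inter> (C' \<union> D') = {}" by blast
  define w where "w y = (if y \<in> ground A C D then u y else u' y)" for y
  have w: "\<And>y. y \<in> ground A C D \<Longrightarrow> w y = u y" "\<And>y. y \<in> ground B C' D' \<Longrightarrow> w y = u' y"
    using index_disjoint assms(3) by (auto simp: w_def)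
  have A: "extension V v A m C D w" by (rule extension_cong[OF ext _ w(1)]) simp_all
  have B: "extension V' v B m C' D' w" by (rule extension_cong[OF ext' _ w(2)]) simp_all
  have "cdd_bound (ground A C D) (vrank w) k"
    by (rule cdd_bound_cong[OF bound]) (simp add: subset_iff w(1) cong: image_cong_simp)
  moreover have "cdd_bound (ground B C' D') (vrank w) k"
    by (rule cdd_bound_cong[OF bound']) (simp add: subset_iff w(2) cong: image_cong_simp)
  ultimately have "cdd_bound (ground A C D \<union> ground B C' D') (vrank w) k"
    using cdd_bound_direct_sum direct_sum_extensions[OF A B index_disjoint assms(3,4)] by blast
  moreover have "ground A C D \<union> ground B C' D' = ground (A \<union> B) (C \<union> C') (D \<union> D')" by blast
  ultimately have "cdd_bound (ground (A \<union> B) (C \<union> C') (D \<union> D')) (vrank w) k" by simp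
  with extension_Un[OF A B index_disjoint]
  show "\<exists>C D u. extension (V \<union> V') v (A \<union> B) m C D u \<and>
      cdd_bound (ground (A \<union> B) C D) (vrank u) k" by blast
qed

lemma extendable_UN:
  fixes n :: nat
  assumes "1 \<le> k" "disjoint_family_on X {..<n}"
    and "\<And>i. i < n \<Longrightarrow> fv.lin_disjoint (\<Union>j<i. V j) (V i)"
    and "\<And>i. i < n \<Longrightarrow> extendable (V i) v (X i) k"
  shows "extendable (\<Union>i<n. V i) v (\<Union>i<n. X i) k"
  using assms(2-4)
proof (induction n)
  case 0
  then show ?case using assms(1) by (intro extendable_small) auto
next
  case (Suc n)
  have "disjoint_family_on X {..<n}"
    using Suc.prems(1) by (rule disjoint_family_on_mono[rotated]) auto
  then have "extendable (\<Union>i<n. V i) v (\<Union>i<n. X i) k" using Suc by simp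
  moreover have "X i \<inter> X n = {}" if "i < n" for i
    using that by (intro disjoint_family_onD[OF Suc.prems(1)]) auto
  then have "(\<Union>i<n. X i) \<inter> X n = {}" by blast
  ultimately have "extendable ((\<Union>i<n. V i) \<union> V n) v ((\<Union>i<n. X i) \<union> X n) k"
    using Suc.prems(2,3) by (intro extendable_Un) auto
  then show ?case by (simp add: lessThan_Suc Un_commute)
qed

text \<open>Contracting \<open>Inr (Suc p)\<close> and deleting \<open>Inr p\<close> recovers \<open>u\<close>; contracting \<open>Inr p\<close> and
  deleting \<open>Inr (Suc p)\<close> adds the rank-one change \<open>fscale (a x) b\<close> to the vector of \<open>x\<close>.\<close>

definition rank_one_extension ::
  "('a + nat \<Rightarrow> nat \<Rightarrow> 'f::field) \<Rightarrow> ('a \<Rightarrow> 'f) \<Rightarrow> (nat \<Rightarrow> 'f) \<Rightarrow> nat \<Rightarrow> 'a + nat \<Rightarrow> nat \<Rightarrow> 'f" where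
  "rank_one_extension u a b p y = (case y of
     Inl x \<Rightarrow> u y + fscale (a x) (b + unit_vec p)
   | Inr i \<Rightarrow> if i = p then unit_vec p else if i = Suc p then b + unit_vec p else u y)"

context extension
begin

context
  fixes a :: "'a \<Rightarrow> 'f" and b :: "nat \<Rightarrow> 'f" and p :: nat
  assumes b_in_span: "b \<in> fv.span V" and m_le_p: "m \<le> p" and C_D_less_p: "C \<union> D \<subseteq> {..<p}"
begin

lemma extension_rank_one:
  assumes w: "\<And>x. x \<in> E \<Longrightarrow> w x = v x + fscale (a x) b"
  shows "extension V w E m (insert p C) (insert (Suc p) D) (rank_one_extension u a b p)"
proof
  have V: "fv.span V \<subseteq> fv.span (V \<union> unit_vec ` insert p C)"
    and units: "fv.span (unit_vec ` C) \<subseteq> fv.span (unit_vec ` insert p C :: (nat \<Rightarrow> 'f) set)"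
    and V_units: "fv.span (V \<union> unit_vec ` C) \<subseteq> fv.span (V \<union> unit_vec ` insert p C)"
    by (rule fv.span_mono, blast)+
  show "finite (insert p C)" "finite (insert (Suc p) D)" by (simp_all add: finite_C finite_D)
  show "insert p C \<inter> insert (Suc p) D = {}" using disjoint C_D_less_p by auto
  show "insert p C \<union> insert (Suc p) D \<subseteq> {m..}" using fresh m_le_p by auto
  show "w ` E \<subseteq> fv.span V"
    using v_in_span b_in_span w by (auto intro!: fv.span_add fv.span_scale)
  show "rank_one_extension u a b p (Inl x) - w x \<in> fv.span (unit_vec ` insert p C)" if "x \<in> E" for x
  proof -
    have "(u (Inl x) - v x) + fscale (a x) (unit_vec p) \<in> fv.span (unit_vec ` insert p C)"
      using diff_in_span[OF that] units
      by (intro fv.span_add fv.span_scale) (auto intro: fv.span_base)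
    then show ?thesis
      by (simp add: rank_one_extension_def w[OF that] fv.scale_right_distrib algebra_simps)
  qed
  show "rank_one_extension u a b p (Inr c) = unit_vec c" if "c \<in> insert p C" for c
    using that C_D_less_p by (auto simp: rank_one_extension_def contracted)
  show "rank_one_extension u a b p (Inr d) \<in> fv.span (V \<union> unit_vec ` insert p C)"
    if "d \<in> insert (Suc p) D" for d
  proof (cases "d = Suc p")
    case True
    have "b + unit_vec p \<in> fv.span (V \<union> unit_vec ` insert p C)"
      using b_in_span V by (intro fv.span_add) (auto intro: fv.span_base)
    then show ?thesis by (simp add: rank_one_extension_def True)
  next
    case False
    then have "d \<in> D" "d \<noteq> p" using that C_D_less_p by auto
    then show ?thesis using False deleted_in_span V_units by (auto simp: rank_one_extension_def)
  qed
qed (rule finite_E V_supported)+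

lemma lin_disjoint_ground_rank_one: "fv.lin_disjoint (u ` ground E C D) {b + unit_vec p}"
proof (rule fv.lin_disjointI)
  fix z assume z: "z \<in> fv.span (u ` ground E C D)" "z \<in> fv.span {b + unit_vec p}"
  from z(2) obtain k where k: "z = fscale k (b + unit_vec p)" by (auto simp: fv.span_singleton)
  have "fv.span (u ` ground E C D) \<subseteq> fv.span (V \<union> unit_vec ` C)"
    by (rule fv.span_minimal[OF image_ground_subset_span]) simp
  then have "z \<in> supported_on ({..<m} \<union> C)" using z(1) span_subset_supported by blast
  moreover have "p \<notin> {..<m} \<union> C" using m_le_p C_D_less_p by auto
  ultimately have "z p = 0" unfolding supported_on_def by blast
  moreover have "b p = 0"
    using b_in_span span_subset_supported_on[OF V_supported] m_le_p by (auto simp: supported_on_def)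
  ultimately show "z = 0" using k by (simp add: fscale_def unit_vec_def fun_eq_iff)
qed

lemma contract_rk_rank_one:
  assumes X: "X \<subseteq> ground E C D"
  shows "contract_rk (vrank (rank_one_extension u a b p)) (Inr (Suc p)) X = vrank u X"
proof -
  let ?w = "rank_one_extension u a b p" and ?f = "b + unit_vec p"
  have "fv.dim (?w ` X \<union> {?f}) = vrank u X + fv.dim {?f}"
  proof (rule fv.dim_image_Un_perturb)
    show "finite X" using X finite_ground by (rule finite_subset)
    show "fv.fin_dim {?f}" by (simp add: fv.fin_dim_finite)
    show "?w y - u y \<in> fv.span {?f}" if "y \<in> X" for y
    proof (cases y)
      case (Inl x)
      then show ?thesis
        by (simp add: rank_one_extension_def fv.span_scale fv.span_base)
    next
      case (Inr i)
      then have "i < p" using X that C_D_less_p by auto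
      then show ?thesis by (simp add: rank_one_extension_def Inr fv.span_zero)
    qed
    have "u ` X \<subseteq> fv.span (u ` ground E C D)"
      using image_mono[OF X] fv.span_superset by (rule subset_trans)
    then show "fv.lin_disjoint (u ` X) {?f}"
      by (rule fv.lin_disjoint_mono[OF lin_disjoint_ground_rank_one _ fv.span_superset])
  qed
  moreover have "?w (Inr (Suc p)) = ?f" by (simp add: rank_one_extension_def)
  ultimately show ?thesis by (simp add: contract_rk_def)
qed

lemma cdd_bound_rank_one:
  assumes "cdd_bound (ground E C D) (vrank u) k"
  shows "cdd_bound (ground E (insert p C) (insert (Suc p) D))
    (vrank (rank_one_extension u a b p)) (k + 2)"
proof -
  let ?w = "rank_one_extension u a b p" and ?G = "ground E (insert p C) (insert (Suc p) D)"
  have "p \<notin> C \<union> D" "Suc p \<notin> C \<union> D" using C_D_less_p by auto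
  then have ground: "?G - {Inr (Suc p)} - {Inr p} = ground E C D" by auto
  have "cdd_bound (?G - {Inr (Suc p)} - {Inr p}) (contract_rk (vrank ?w) (Inr (Suc p))) k"
    unfolding ground by (rule cdd_bound_cong[OF assms contract_rk_rank_one])
  then have "cdd_bound (?G - {Inr (Suc p)}) (contract_rk (vrank ?w) (Inr (Suc p))) (Suc k)"
    by (rule cdd_bound.delete[rotated]) simp
  then have "cdd_bound ?G (vrank ?w) (Suc (Suc k))"
    by (rule cdd_bound.contract[rotated]) simp
  then show ?thesis by simp
qed

end

end

lemma extendable_rank_one:
  assumes "extendable V v E k" "b \<in> fv.span V" "\<And>x. x \<in> E \<Longrightarrow> w x - v x \<in> fv.span {b}"
  shows "extendable V w E (k + 2)"
  unfolding extendable_def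
proof (intro allI impI)
  fix m assume "V \<subseteq> supported_on {..<m}"
  with assms(1) obtain C D u where ext: "extension V v E m C D u"
    and bound: "cdd_bound (ground E C D) (vrank u) k" by (rule extendableE)
  interpret extension V v E m C D u by (rule ext)
  obtain n where "C \<union> D \<subseteq> {..<n}"
    using finite_nat_bounded[of "C \<union> D"] finite_C finite_D by blast
  then have p: "m \<le> max m n" "C \<union> D \<subseteq> {..<max m n}" by auto
  have "\<exists>c. w x = v x + fscale c b" if "x \<in> E" for x
    using assms(3)[OF that] by (auto simp: fv.span_singleton algebra_simps)
  then obtain a where "\<And>x. x \<in> E \<Longrightarrow> w x = v x + fscale (a x) b" by metis
  then show "\<exists>C D u. extension V w E m C D u \<and> cdd_bound (ground E C D) (vrank u) (k + 2)"
    using extension_rank_one[OF assms(2) p] cdd_bound_rank_one[OF assms(2) p bound] by blast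
qed

lemma extendable_perturb:
  assumes "finite W" "W \<subseteq> fv.span V" "extendable V v E k"
    and "\<And>x. x \<in> E \<Longrightarrow> w x - v x \<in> fv.span W"
  shows "extendable V w E (k + 2 * card W)"
  using assms(1,2,4)
proof (induction W arbitrary: w rule: finite_induct)
  case empty
  then have "w x = v x" if "x \<in> E" for x
    using that by (metis fv.span_empty singletonD eq_iff_diff_eq_0)
  then show ?case using extendable_cong[OF assms(3), of w] by simp
next
  case (insert b W)
  have "\<exists>c. w x - v x - fscale c b \<in> fv.span W" if "x \<in> E" for x
    using insert.prems(2)[OF that] unfolding fv.span_breakdown_eq .
  then obtain c where c: "\<And>x. x \<in> E \<Longrightarrow> w x - v x - fscale (c x) b \<in> fv.span W" by metis
  define w' where "w' x = w x - fscale (c x) b" for x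
  have "w' x - v x \<in> fv.span W" if "x \<in> E" for x
    using c[OF that] by (simp add: w'_def diff_right_commute)
  then have "extendable V w' E (k + 2 * card W)" using insert.prems(1) insert.IH[of w'] by blast
  moreover have "w x - w' x \<in> fv.span {b}" for x
    by (simp add: w'_def fv.span_scale fv.span_base)
  ultimately have "extendable V w E (k + 2 * card W + 2)"
    using insert.prems(1) by (intro extendable_rank_one[of V w' E _ b w]) auto
  then show ?case using insert.hyps by simp
qed

lemma extendable_block_projection:
  fixes v v' :: "'a \<Rightarrow> nat \<Rightarrow> 'f::field"
  assumes proj: "fv.block_projection v X n v'"
    and disjoint: "disjoint_family_on X {..<n}" and fin: "\<And>i. i < n \<Longrightarrow> finite (X i)"
    and "1 \<le> k" and ext: "\<And>i. i < n \<Longrightarrow> extendable (v' ` X i) v' (X i) k"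
  defines "E \<equiv> \<Union>i<n. X i" and "U \<equiv> \<Union>i<n. fv.overlap (\<lambda>j. v ` X j) i"
  shows "extendable (v ` E) v E (k + 2 * fv.dim U)"
proof -
  have span_block: "fv.span (v ` X i) \<subseteq> fv.span (v ` E)" if "i < n" for i
    by (rule fv.span_mono) (use that in \<open>auto simp: E_def\<close>)
  have "extendable (\<Union>i<n. v' ` X i) v' E k"
    unfolding E_def using ext fv.lin_disjoint_block_projection[OF proj] disjoint \<open>1 \<le> k\<close>
    by (intro extendable_UN) auto
  moreover have "(\<Union>i<n. v' ` X i) \<subseteq> fv.span (v ` E)"
    using proj span_block unfolding fv.block_projection_def by blast
  ultimately have "extendable (v ` E) v' E k" by (rule extendable_mono) simp
  moreover have fd: "fv.fin_dim U"
    unfolding U_def using fin by (intro fv.fin_dim_UN_overlap fv.fin_dim_finite) auto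
  obtain W where W: "W \<subseteq> U" "finite W" "U \<subseteq> fv.span W" "card W = fv.dim U"
    using fv.finite_basis_exists[OF fd] by metis
  have "U \<subseteq> fv.span (v ` E)" using span_block by (auto simp: U_def fv.overlap_def)
  then have "W \<subseteq> fv.span (v ` E)" using W(1) by blast
  moreover have "v x - v' x \<in> fv.span W" if "x \<in> E" for x
  proof -
    have "v x - v' x \<in> fv.span U"
      using fv.block_projection_diff_in_span[OF proj] that unfolding E_def U_def .
    then show ?thesis using fv.span_minimal[OF W(3)] by auto
  qed
  ultimately have "extendable (v ` E) v E (k + 2 * card W)"
    using W(2) by (intro extendable_perturb)
  then show ?thesis by (simp add: W(4))
qed

section \<open>Rooted decompositions\<close>

lemma depth_le_fold_max: "t \<in> set ts \<Longrightarrow> depth t \<le> fold max (map depth ts) 0"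
  using Max.set_eq_fold[of 0 "map depth ts"]
  by (metis (no_types, lifting) List.finite_set Max_ge image_eqI list.set_intros(2) set_map)

lemma leaves_nonempty: "width_ok rk r T \<Longrightarrow> leaves T \<noteq> []"
proof (induction T)
  case (Node ts)
  then have "hd ts \<in> set ts" by simp
  then show ?case using Node.IH[of "hd ts"] Node.prems by (auto simp: list_all_iff)
qed simp

lemma disjoint_family_on_distinct_concat:
  "distinct (concat xss) \<Longrightarrow> disjoint_family_on (\<lambda>i. set (xss ! i)) {..<length xss}"
proof (induction xss)
  case Nil
  then show ?case by (simp add: disjoint_family_on_def)
next
  case (Cons xs xss)
  have head: "set xs \<inter> set (xss ! i) = {}" if "i < length xss" for i
    using Cons.prems nth_mem[OF that] by auto
  have tail: "set (xss ! i) \<inter> set (xss ! j) = {}"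
    if "i < length xss" "j < length xss" "i \<noteq> j" for i j
    using Cons that by (simp add: disjoint_family_on_def)
  have "set ((xs # xss) ! i) \<inter> set ((xs # xss) ! j) = {}"
    if "i < length (xs # xss)" "j < length (xs # xss)" "i \<noteq> j" for i j
    using that head tail by (cases i; cases j) (simp_all add: Int_commute)
  then show ?case by (simp add: disjoint_family_on_def)
qed

lemma width_ok_perturb:
  assumes "width_ok rk r T"
    and "\<And>X Y. X \<subseteq> set (leaves T) \<Longrightarrow> Y \<subseteq> set (leaves T) \<Longrightarrow> lam rk' X Y \<le> lam rk X Y + s"
  shows "width_ok rk' (r + s) T"
  using assms
proof (induction T)
  case (Leaf x)
  then show ?case by simp
next
  case (Node ts)
  let ?P = "{..<length ts}" and ?X = "\<lambda>i. set (leaves (ts ! i))"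
  have sub: "(\<Union>i\<in>I. ?X i) \<subseteq> set (leaves (Node ts))" if "I \<subseteq> ?P" for I
    using that by (auto dest: nth_mem)
  have "lam_star rk' ?P ?X \<le> r + s"
    unfolding lam_star_def
  proof (rule Max.boundedI)
    fix k assume "k \<in> {lam rk' (\<Union>i\<in>I. ?X i) (\<Union>i\<in>?P - I. ?X i) | I. I \<subseteq> ?P}"
    then obtain I where I: "I \<subseteq> ?P" "k = lam rk' (\<Union>i\<in>I. ?X i) (\<Union>i\<in>?P - I. ?X i)" by blast
    have "k \<le> lam rk (\<Union>i\<in>I. ?X i) (\<Union>i\<in>?P - I. ?X i) + s"
      unfolding I(2) by (intro Node.prems sub I) auto
    also have "\<dots> \<le> lam_star rk ?P ?X + s" using lam_le_lam_star[OF _ I(1)] by simp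
    also have "\<dots> \<le> r + s" using Node.prems(1) by simp
    finally show "k \<le> r + s" .
  qed auto
  moreover have "width_ok rk' (r + s) t" if "t \<in> set ts" for t
  proof (rule Node.IH[OF that])
    show "width_ok rk r t" using Node.prems(1) that by (simp add: list_all_iff)
    fix X Y assume "X \<subseteq> set (leaves t)" "Y \<subseteq> set (leaves t)"
    then show "lam rk' X Y \<le> lam rk X Y + s" using that by (intro Node.prems) auto
  qed
  ultimately show ?case using Node.prems(1) by (simp add: list_all_iff)
qed

lemma width_ok_cong:
  assumes "width_ok rk r T" "\<And>X. X \<subseteq> set (leaves T) \<Longrightarrow> rk' X = rk X"
  shows "width_ok rk' r T"
  using width_ok_perturb[OF assms(1), of rk' 0] assms(2) by (simp add: lam_def)

definition depth_bound :: "nat \<Rightarrow> nat \<Rightarrow> nat" where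
  "depth_bound r d = 2 * r * (4 ^ d - 1) + 1"

lemma depth_bound_mono: "d \<le> d' \<Longrightarrow> depth_bound r d \<le> depth_bound r d'"
  unfolding depth_bound_def
  by (intro add_mono mult_le_mono diff_le_mono power_increasing) simp_all

lemma depth_bound_Suc: "depth_bound r (Suc d) = depth_bound (4 * r) d + 6 * r"
proof -
  obtain q where "(4::nat) ^ d = Suc q" by (metis not0_implies_Suc power_not_zero zero_neq_numeral)
  then show ?thesis by (simp add: depth_bound_def algebra_simps)
qed

lemma width_ok_block_projection:
  fixes v v' :: "'a \<Rightarrow> nat \<Rightarrow> 'f::field" and ts :: "'a rtree list"
  defines "X \<equiv> \<lambda>i. set (leaves (ts ! i))"
  assumes width: "width_ok (vrank v) r (Node ts)" and "i < length ts"
    and proj: "fv.block_projection v X (length ts) v'"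
  shows "width_ok (vrank v') (4 * r) (ts ! i)"
proof -
  have dim_overlap: "fv.dim (\<Union>i<length ts. fv.overlap (\<lambda>j. v ` X j) i) \<le> 3 * r"
    using fv.dim_UN_overlap_le_lam_star[of "length ts" X v] width by (simp add: X_def)
  have "width_ok (vrank v') (r + 3 * r) (ts ! i)"
  proof (rule width_ok_perturb)
    show "width_ok (vrank v) r (ts ! i)" using width assms(3) by (simp add: list_all_length)
    fix Y Z assume "Y \<subseteq> set (leaves (ts ! i))" "Z \<subseteq> set (leaves (ts ! i))"
    then have "lam (vrank v') Y Z
        \<le> lam (vrank v) Y Z + fv.dim (\<Union>i<length ts. fv.overlap (\<lambda>j. v ` X j) i)"
      by (intro fv.lam_block_projection_le[OF proj assms(3)]) (simp_all add: X_def)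
    then show "lam (vrank v') Y Z \<le> lam (vrank v) Y Z + 3 * r" using dim_overlap by linarith
  qed
  then show ?thesis by simp
qed

lemma extendable_decomposition:
  fixes v :: "'a \<Rightarrow> nat \<Rightarrow> 'f::field"
  assumes "distinct (leaves T)" "width_ok (vrank v) r T"
  shows "extendable (v ` set (leaves T)) v (set (leaves T)) (depth_bound r (depth T))"
  using assms
proof (induction T arbitrary: v r)
  case (Leaf x)
  show ?case by (rule extendable_small[of _ x]) (auto simp: depth_bound_def intro: fv.span_base)
next
  case (Node ts)
  let ?X = "\<lambda>i. set (leaves (ts ! i))" and ?n = "length ts" and ?d = "fold max (map depth ts) 0"
  let ?U = "\<Union>i<?n. fv.overlap (\<lambda>j. v ` ?X j) i"
  have "disjoint_family_on (\<lambda>i. set (map leaves ts ! i)) {..<length (map leaves ts)}"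
    using Node.prems(1) by (intro disjoint_family_on_distinct_concat) simp
  then have disjoint: "disjoint_family_on ?X {..<?n}" by (simp add: disjoint_family_on_def)
  then obtain v' :: "'a \<Rightarrow> nat \<Rightarrow> 'f" where proj: "fv.block_projection v ?X ?n v'"
    using fv.block_projection_exists by blast
  have "extendable (v' ` ?X i) v' (?X i) (depth_bound (4 * r) ?d)" if "i < ?n" for i
  proof -
    have t: "ts ! i \<in> set ts" using that by simp
    have "distinct (leaves (ts ! i))" using Node.prems(1) t by (simp add: distinct_concat_iff)
    then have "extendable (v' ` ?X i) v' (?X i) (depth_bound (4 * r) (depth (ts ! i)))"
      by (rule Node.IH[OF t _ width_ok_block_projection[OF Node.prems(2) that proj]])
    then show ?thesis
      by (rule extendable_mono) (auto intro: fv.span_base depth_bound_mono depth_le_fold_max t)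
  qed
  then have "extendable (v ` (\<Union>i<?n. ?X i)) v (\<Union>i<?n. ?X i)
      (depth_bound (4 * r) ?d + 2 * fv.dim ?U)"
    by (intro extendable_block_projection[OF proj disjoint]) (simp_all add: depth_bound_def)
  moreover have "fv.dim ?U \<le> 3 * r"
    using fv.dim_UN_overlap_le_lam_star[of ?n ?X v] Node.prems(2) by simp
  then have "depth_bound (4 * r) ?d + 2 * fv.dim ?U \<le> depth_bound r (depth (Node ts))"
    by (simp add: depth_bound_Suc)
  moreover have "set ts = (!) ts ` {..<?n}" by (auto simp: set_conv_nth)
  then have "(\<Union>i<?n. ?X i) = set (leaves (Node ts))" by simp
  ultimately show ?case by (metis extendable_mono fv.span_superset)
qed

theorem theorem4p1:
  fixes E :: "'a set" and rk :: "'a set \<Rightarrow> nat" and d r :: nat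
  assumes "representable TYPE('f::field) E rk"
    and "has_rooted_decomposition E rk d r"
  shows "\<exists>(E' :: ('a + nat) set) rk'. representable TYPE('f) E' rk' \<and>
           is_minor E rk E' rk' \<and> cdd E' rk' \<le> 2 * r * (4 ^ d - 1) + 1"
proof -
  obtain v :: "'a \<Rightarrow> nat \<Rightarrow> 'f" and m where supp: "v ` E \<subseteq> supported_on {..<m}"
    and rk: "\<And>X. X \<subseteq> E \<Longrightarrow> rk X = vrank v X"
    using assms(1) unfolding representable_iff_vrank by blast
  obtain T where T: "distinct (leaves T)" "set (leaves T) = E" "depth T = d" "width_ok rk r T"
    using assms(2) unfolding has_rooted_decomposition_def rooted_decomposition_def by blast
  have "width_ok (vrank v) r T" by (rule width_ok_cong[OF T(4)]) (simp add: T(2) rk)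
  then have "extendable (v ` E) v E (depth_bound r d)" using extendable_decomposition T by blast
  then obtain C D u where ext: "extension (v ` E) v E m C D u"
    and bound: "cdd_bound (ground E C D) (vrank u) (depth_bound r d)"
    using supp by (rule extendableE)
  interpret extension "v ` E" v E m C D u by (rule ext)
  have "ground E C D \<noteq> {}" using leaves_nonempty[OF T(4)] T(2) by auto
  then have "cdd (ground E C D) (vrank u) \<le> 2 * r * (4 ^ d - 1) + 1"
    using cdd_upper_bound[OF bound matroid_rank_ground] by (simp add: depth_bound_def)
  then show ?thesis using representable_ground is_minor_ground[OF rk] by blast
qed

end
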